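(* Let $K$ be an algebraically closed field and let $S=\langle n_1,n_2,n_3,n_4\rangle$ be a $4$-generated pseudo-symmetric numerical semigroup with $n_1<n_2<n_3<n_4$, with associated integer parameters $\alpha_1,\alpha_2,\alpha_3,\alpha_4,\alpha_{21}$ (see context). Assume $\alpha_2>\alpha_{21}+1$ and $\alpha_4=2$, and let $k$ be the smallest positive integer such that $$k(\alpha_2+1)<(k-1)\alpha_1+(k+1)\alpha_{21}+\alpha_3 .$$ Then the numerator of the Hilbert series of the local ring $R_S=K[[t^{n_1},t^{n_2},t^{n_3},t^{n_4}]]$, i.e. the polynomial $P(I_S^* )\in\mathbb{Z}[t]$ with $HS_{R_S}(t)=\dfrac{P(I_S^* )}{(1-t)^4}$, is $$P(I_S^* )=1-3t^2+3t^3-t^4-t^{\alpha_{21}+1}(1-t)^3-t^{\alpha_3}(1-t)-t^{\alpha_2+1}(1-t)(1-t^{\alpha_3-1})-t^{k\alpha_2+1}(1-t)^2-r(t),$$ where $r(t)=0$ if $k=1$, and $$r(t)=\sum_{j=2}^{k} t^{(k-j)\alpha_1+(k-j+2)\alpha_{21}+\alpha_3+j-k}(1-t)^2(1-t^{\alpha_2})$$ if $k>1$.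
   Context: Semigroup. For positive integers $n_1,\dots,n_4$ with $\gcd(n_1,\dots,n_4)=1$, $S=\langle n_1,n_2,n_3,n_4\rangle=\{\sum u_in_i : u_i\in\mathbb{N}\}$. $S$ is pseudo-symmetric if its Frobenius number $F$ (the largest integer not in $S$) is even and $F-x\in S$ for every integer $x\notin S$ with $x\neq F/2$. "4-generated" means $n_1,\dots,n_4$ minimally generate $S$. Parameters. By a theorem of Komeda, which is assumed as the standing description of these semigroups, the $4$-generated pseudo-symmetric semigroup $S$ is given by integers $\alpha_i>1$ ($1\le i\le 4$) and $\alpha_{21}$ with $0<\alpha_{21}<\alpha_1-1$ such that $n_1=\alpha_2\alpha_3(\alpha_4-1)+1$, $n_2=\alpha_{21}\alpha_3\alpha_4+(\alpha_1-\alpha_{21}-1)(\alpha_3-1)+\alpha_3$, $n_3=\alpha_1\alpha_4+(\alpha_1-\alpha_{21}-1)(\alpha_2-1)(\alpha_4-1)-\alpha_4+1$, $n_4=\alpha_1\alpha_2(\alpha_3-1)+\alpha_{21}(\alpha_2-1)+\alpha_2$. Toric ideal. $I_S$ is the kernel of the $K$-algebra map $A=K[X_1,X_2,X_3,X_4]\to K[t]$, $X_i\mapsto t^{n_i}$. By the same known theorem, $I_S$ is generated by $X_1^{\alpha_1}-X_3X_4^{\alpha_4-1}$, $X_2^{\alpha_2}-X_1^{\alpha_{21}}X_4$, $X_3^{\alpha_3}-X_1^{\alpha_1-\alpha_{21}-1}X_2$, $X_4^{\alpha_4}-X_1X_2^{\alpha_2-1}X_3^{\alpha_3-1}$, $X_1^{\alpha_{21}+1}X_3^{\alpha_3-1}-X_2X_4^{\alpha_4-1}$.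 Hilbert series. Let $\mathfrak{m}=\langle t^{n_1},\dots,t^{n_4}\rangle$ be the maximal ideal of $R_S$. The Hilbert function is $H_{R_S}(n)=\dim_{R_S/\mathfrak{m}}(\mathfrak{m}^n/\mathfrak{m}^{n+1})$ for $n\ge 0$, and $HS_{R_S}(t)=\sum_{n\ge0}H_{R_S}(n)t^n$. The associated graded ring $\bigoplus_{i\ge0}\mathfrak{m}^i/\mathfrak{m}^{i+1}$ is isomorphic to $A/I_S^*$, where $I_S^*=\langle f^* : f\in I_S\rangle$ and $f^*$ is the homogeneous summand of $f$ of least degree; $HS_{R_S}(t)$ is the Hilbert series of $A/I_S^*$ with the standard grading. *)

theory Defs
  imports
    "Jordan_Normal_Form.Missing_VectorSpace"
    "HOL-Algebra.Ideal_Product"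
    "HOL-Algebra.QuotRing"
    "HOL-Computational_Algebra.Polynomial_FPS"
begin

subsection \<open>Numerical semigroups\<close>

definition semigroup_gen :: "nat set \<Rightarrow> nat set" where
  "semigroup_gen G = {\<Sum>g\<in>G. u g * g | u. True}"

definition minimally_generates :: "nat set \<Rightarrow> nat set \<Rightarrow> bool" where
  "minimally_generates G S \<longleftrightarrow>
     semigroup_gen G = S \<and> (\<forall>g\<in>G. semigroup_gen (G - {g}) \<noteq> S)"

text \<open>The complement is taken in the integers, so that the Frobenius number of
  the semigroup of all natural numbers is \<open>-1\<close>.\<close>

definition frobenius :: "nat set \<Rightarrow> int" where
  "frobenius S = (GREATEST x. x \<notin> int ` S)"

definition pseudo_symmetric :: "nat set \<Rightarrow> bool" where
  "pseudo_symmetric S \<longleftrightarrow> even (frobenius S) \<and>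
     (\<forall>x. x \<notin> int ` S \<and> x \<noteq> frobenius S div 2 \<longrightarrow> frobenius S - x \<in> int ` S)"

subsection \<open>The ring of power series in given powers of the indeterminate\<close>

text \<open>The image of the substitution map that sends a power series
  \<open>\<Sum>u. c u * (\<Prod>g\<in>G. X g ^ u g)\<close> in indeterminates \<open>X g\<close>, one for each \<open>g \<in> G\<close>,
  to \<open>\<Sum>u. c u * t ^ (\<Sum>g\<in>G. u g * g)\<close>. The inner sum below is finite as soon as
  \<open>G\<close> is a finite set of positive numbers.\<close>

definition subst_powers :: "nat set \<Rightarrow> ((nat \<Rightarrow> nat) \<Rightarrow> 'a::field) \<Rightarrow> 'a fps" where
  "subst_powers G c =
     Abs_fps (\<lambda>i. \<Sum>u | u \<in> G \<rightarrow>\<^sub>E UNIV \<and> (\<Sum>g\<in>G. u g * g) = i. c u)"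

definition semigroup_ring :: "nat set \<Rightarrow> 'a::field fps ring" where
  "semigroup_ring G =
     \<lparr>carrier = range (subst_powers G), monoid.mult = (*), one = 1, zero = 0, add = (+)\<rparr>"

definition semigroup_max_ideal :: "nat set \<Rightarrow> 'a::field fps set" where
  "semigroup_max_ideal G = Idl\<^bsub>semigroup_ring G\<^esub> ((\<lambda>g. fps_X ^ g) ` G)"

lemma finite_factorizations:
  assumes "finite G" "0 \<notin> G"
  shows "finite {u \<in> G \<rightarrow>\<^sub>E UNIV. (\<Sum>g\<in>G. u g * g) = (i::nat)}"
proof (rule finite_subset)
  show "{u \<in> G \<rightarrow>\<^sub>E UNIV. (\<Sum>g\<in>G. u g * g) = i} \<subseteq> G \<rightarrow>\<^sub>E {..i}"
  proof
    fix u assume u: "u \<in> {u \<in> G \<rightarrow>\<^sub>E UNIV. (\<Sum>g\<in>G. u g * g) = i}"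
    have "u g \<le> i" if g: "g \<in> G" for g
    proof -
      have "u g \<le> u g * g" using g assms(2) by (cases g) auto
      also have "\<dots> \<le> (\<Sum>g\<in>G. u g * g)" by (rule member_le_sum) (use g assms in auto)
      finally show ?thesis using u by simp
    qed
    with u show "u \<in> G \<rightarrow>\<^sub>E {..i}" by (auto simp: PiE_def Pi_def)
  qed
  show "finite (G \<rightarrow>\<^sub>E {..i})" using assms by (intro finite_PiE) auto
qed

lemma carrier_semigroup_ring:
  assumes "finite G" "0 \<notin> G"
  shows "carrier (semigroup_ring G) = {f. \<forall>i. fps_nth f i \<noteq> 0 \<longrightarrow> i \<in> semigroup_gen G}"
proof (intro equalityI subsetI)
  fix f :: "'a fps" assume "f \<in> carrier (semigroup_ring G)"
  then obtain c where f: "f = subst_powers G c" by (auto simp: semigroup_ring_def)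
  show "f \<in> {f. \<forall>i. fps_nth f i \<noteq> 0 \<longrightarrow> i \<in> semigroup_gen G}"
  proof (clarsimp)
    fix i assume "fps_nth f i \<noteq> 0"
    then have "{u. u \<in> G \<rightarrow>\<^sub>E UNIV \<and> (\<Sum>g\<in>G. u g * g) = i} \<noteq> {}"
      unfolding f subst_powers_def by (metis (no_types, lifting) fps_nth_Abs_fps sum.empty)
    then show "i \<in> semigroup_gen G" by (auto simp: semigroup_gen_def)
  qed
next
  fix f :: "'a fps" assume "f \<in> {f. \<forall>i. fps_nth f i \<noteq> 0 \<longrightarrow> i \<in> semigroup_gen G}"
  then have f: "i \<in> semigroup_gen G" if "fps_nth f i \<noteq> 0" for i using that by blast
  define w where "w i = (SOME u. u \<in> G \<rightarrow>\<^sub>E UNIV \<and> (\<Sum>g\<in>G. u g * g) = i)" for i :: nat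
  have w: "w i \<in> G \<rightarrow>\<^sub>E UNIV \<and> (\<Sum>g\<in>G. w i g * g) = i" if "i \<in> semigroup_gen G" for i
  proof -
    from that obtain u where u: "i = (\<Sum>g\<in>G. u g * g)" by (auto simp: semigroup_gen_def)
    have "restrict u G \<in> G \<rightarrow>\<^sub>E UNIV \<and> (\<Sum>g\<in>G. restrict u G g * g) = i"
      unfolding u by auto
    then show ?thesis unfolding w_def by (rule someI[of "\<lambda>u. u \<in> G \<rightarrow>\<^sub>E UNIV \<and> (\<Sum>g\<in>G. u g * g) = i"])
  qed
  define c where "c u = (let i = \<Sum>g\<in>G. u g * g in if u = w i then fps_nth f i else 0)" for u
  have "subst_powers G c = f"
  proof (rule fps_ext)
    fix i
    let ?A = "{u \<in> G \<rightarrow>\<^sub>E UNIV. (\<Sum>g\<in>G. u g * g) = i}"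
    have "fps_nth (subst_powers G c) i = (\<Sum>u\<in>?A. if u = w i then fps_nth f i else 0)"
      unfolding subst_powers_def by (auto simp: c_def intro!: sum.cong)
    also have "\<dots> = (if w i \<in> ?A then fps_nth f i else 0)"
      using finite_factorizations[OF assms, of i] by (simp add: sum.delta)
    also have "\<dots> = fps_nth f i" using f[of i] w[of i] by auto
    finally show "fps_nth (subst_powers G c) i = fps_nth f i" .
  qed
  then show "f \<in> carrier (semigroup_ring G)" by (auto simp: semigroup_ring_def)
qed

lemma zero_in_semigroup_gen: "0 \<in> semigroup_gen G"
  unfolding semigroup_gen_def by (auto intro!: exI[of _ "\<lambda>_. 0"])

lemma add_in_semigroup_gen:
  assumes "x \<in> semigroup_gen G" "y \<in> semigroup_gen G"
  shows "x + y \<in> semigroup_gen G"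
proof -
  from assms obtain u v where "x = (\<Sum>g\<in>G. u g * g)" "y = (\<Sum>g\<in>G. v g * g)"
    by (auto simp: semigroup_gen_def)
  then have "x + y = (\<Sum>g\<in>G. (u g + v g) * g)" by (simp add: sum.distrib algebra_simps)
  then show ?thesis by (auto simp: semigroup_gen_def)
qed

lemma cring_semigroup_ring:
  assumes "finite G" "0 \<notin> G"
  shows "cring (semigroup_ring G :: 'a::field fps ring)"
proof (rule cringI)
  note c = carrier_semigroup_ring[OF assms]
  show "abelian_group (semigroup_ring G :: 'a fps ring)"
  proof (rule abelian_groupI)
    fix x y :: "'a fps"
    assume "x \<in> carrier (semigroup_ring G)" "y \<in> carrier (semigroup_ring G)"
    then show "x \<oplus>\<^bsub>semigroup_ring G\<^esub> y \<in> carrier (semigroup_ring G)"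
      unfolding c by (auto simp: semigroup_ring_def) (metis add_0)
  next
    fix x :: "'a fps"
    assume "x \<in> carrier (semigroup_ring G)"
    then show "\<exists>y\<in>carrier (semigroup_ring G). y \<oplus>\<^bsub>semigroup_ring G\<^esub> x = \<zero>\<^bsub>semigroup_ring G\<^esub>"
      unfolding c by (intro bexI[of _ "-x"]) (auto simp: semigroup_ring_def)
  qed (unfold c, auto simp: semigroup_ring_def algebra_simps)
  show "comm_monoid (semigroup_ring G :: 'a fps ring)"
  proof (rule comm_monoidI)
    fix x y :: "'a fps"
    assume xy: "x \<in> carrier (semigroup_ring G)" "y \<in> carrier (semigroup_ring G)"
    show "x \<otimes>\<^bsub>semigroup_ring G\<^esub> y \<in> carrier (semigroup_ring G)"
      unfolding c
    proof (clarsimp simp: semigroup_ring_def)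
      fix i assume "fps_nth (x * y) i \<noteq> 0"
      then obtain j where j: "j \<le> i" "fps_nth x j * fps_nth y (i - j) \<noteq> 0"
        unfolding fps_mult_nth by (meson atLeastAtMost_iff sum.not_neutral_contains_not_neutral)
      then have "j \<in> semigroup_gen G" "i - j \<in> semigroup_gen G" using xy unfolding c by auto
      from add_in_semigroup_gen[OF this] j show "i \<in> semigroup_gen G" by simp
    qed
  next
    show "\<one>\<^bsub>semigroup_ring G\<^esub> \<in> carrier (semigroup_ring G :: 'a fps ring)"
      unfolding c by (auto simp: semigroup_ring_def zero_in_semigroup_gen)
  qed (auto simp: semigroup_ring_def algebra_simps)
qed (auto simp: semigroup_ring_def algebra_simps)

subsection \<open>Hilbert function and Hilbert series of a local ring\<close>

primrec ideal_power :: "('a, 'b) ring_scheme \<Rightarrow> 'a set \<Rightarrow> nat \<Rightarrow> 'a set" where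
  "ideal_power R I 0 = carrier R"
| "ideal_power R I (Suc n) = ideal_prod R (ideal_power R I n) I"

text \<open>The \<open>R/m\<close>-module \<open>m^n/m^(n+1)\<close>. The operation \<^const>\<open>rcoset_mult\<close> modulo
  \<open>m^(n+1)\<close>, applied to \<open>r + m\<close> and \<open>x + m^(n+1)\<close> with \<open>x \<in> m^n\<close>, yields
  \<open>r x + m^(n+1)\<close>. The fields \<open>monoid.mult\<close> and \<open>one\<close> play no role in a module.\<close>

definition graded_piece ::
    "('a, 'b) ring_scheme \<Rightarrow> 'a set \<Rightarrow> nat \<Rightarrow> ('a set, 'a set) module" where
  "graded_piece R m n =
     (let J = ideal_power R m (Suc n) in
      \<lparr>carrier = (\<lambda>x. J +>\<^bsub>R\<^esub> x) ` ideal_power R m n,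
       monoid.mult = rcoset_mult R J, one = J +>\<^bsub>R\<^esub> \<one>\<^bsub>R\<^esub>, zero = J, add = set_add R,
       module.smult = rcoset_mult R J\<rparr>)"

lemma (in cring) ideal_ideal_power:
  assumes "ideal m R" shows "ideal (ideal_power R m n) R"
  by (induction n) (use assms in \<open>auto intro: ideal_prod_is_ideal oneideal\<close>)

lemma (in cring) graded_piece_smult:
  assumes m: "ideal m R" and a: "a \<in> carrier R" and x: "x \<in> ideal_power R m n"
  shows "rcoset_mult R (ideal_power R m (Suc n)) (m +> a) (ideal_power R m (Suc n) +> x)
           = ideal_power R m (Suc n) +> (a \<otimes> x)"
proof -
  define J where "J = ideal_power R m (Suc n)"
  define P where "P = ideal_power R m n"
  have J: "ideal J R" and P: "ideal P R" unfolding J_def P_def by (rule ideal_ideal_power[OF m])+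
  interpret m: ideal m R by fact
  interpret J: ideal J R by fact
  interpret P: ideal P R by fact
  have PJ: "p \<otimes> q \<in> J" if "p \<in> m" "q \<in> P" for p q
  proof -
    have "q \<otimes> p \<in> J" unfolding J_def P_def using that by (auto simp: P_def intro: ideal_prod.prod)
    then show ?thesis using that m_comm by auto
  qed
  have xc: "x \<in> carrier R" using x P.Icarr by (auto simp: P_def)
  have "J +> (a' \<otimes> x') = J +> (a \<otimes> x)" if a': "a' \<in> m +> a" and x': "x' \<in> J +> x" for a' x'
  proof -
    obtain p j where p: "p \<in> m" "a' = p \<oplus> a" and j: "j \<in> J" "x' = j \<oplus> x"
      using a' x' by (auto simp: a_r_coset_def')
    have pc: "p \<in> carrier R" "j \<in> carrier R" using p j by auto
    have "a' \<otimes> x' = (p \<otimes> j \<oplus> a \<otimes> j \<oplus> p \<otimes> x) \<oplus> a \<otimes> x"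
      unfolding p j using pc a xc by algebra
    moreover have "p \<otimes> j \<oplus> a \<otimes> j \<oplus> p \<otimes> x \<in> J"
      using p j a x pc PJ by (auto simp: P_def J.I_l_closed)
    ultimately have "a' \<otimes> x' \<in> J +> (a \<otimes> x)" by (auto simp: a_r_coset_def')
    then show ?thesis using a_repr_independence[OF _ _ J.a_subgroup] a xc by auto
  qed
  moreover have "a \<in> m +> a" "x \<in> J +> x" using a xc by (auto intro: m.a_rcos_self J.a_rcos_self)
  ultimately show ?thesis unfolding rcoset_mult_def J_def[symmetric] by (fast)
qed

lemma (in cring) module_graded_piece:
  assumes m: "ideal m R"
  shows "Module.module (R Quot m) (graded_piece R m n)"
proof -
  define J where "J = ideal_power R m (Suc n)"
  define P where "P = ideal_power R m n"
  have J: "ideal J R" and P: "ideal P R" unfolding J_def P_def by (rule ideal_ideal_power[OF m])+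
  interpret m: ideal m R by fact
  interpret J: ideal J R by fact
  interpret P: ideal P R by fact
  have sm: "rcoset_mult R J (m +> a) (J +> x) = J +> (a \<otimes> x)" if "a \<in> carrier R" "x \<in> P" for a x
    using graded_piece_smult[OF m, of a x n] that by (simp add: J_def P_def)
  have g: "carrier (graded_piece R m n) = (\<lambda>x. J +> x) ` P"
    "add (graded_piece R m n) = set_add R" "zero (graded_piece R m n) = J"
    "module.smult (graded_piece R m n) = rcoset_mult R J"
    by (auto simp: graded_piece_def Let_def J_def P_def)
  have q: "carrier (R Quot m) = (\<lambda>x. m +> x) ` carrier R" "add (R Quot m) = set_add R"
    "monoid.mult (R Quot m) = rcoset_mult R m" "one (R Quot m) = m +> \<one>"
    by (auto simp: FactRing_simps)
  note s = P.Icarr J.a_rcos_sum m.a_rcos_sum sm m.rcoset_mult_add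
  show ?thesis
  proof (rule Module.moduleI)
    show "cring (R Quot m)" by (rule m.quotient_is_cring) (rule is_cring)
    show "abelian_group (graded_piece R m n)"
    proof (rule abelian_groupI, goal_cases)
      case (6 x)
      then obtain y where y: "y \<in> P" "x = J +> y" by (auto simp: g)
      show ?case unfolding g
        by (intro bexI[of _ "J +> (\<ominus> y)"])
          (use y in \<open>auto simp: s l_neg a_coset_add_zero[OF J.a_subset]\<close>)
    next
      case 2
      have "J = J +> \<zero>" by (simp add: J.a_subset)
      then show ?case unfolding g using P.zero_closed by blast
    next
      case (5 x)
      then obtain y where y: "y \<in> P" "x = J +> y" by (auto simp: g)
      have "set_add R J (J +> y) = set_add R (J +> \<zero>) (J +> y)" by (simp add: J.a_subset)
      then show ?case using y by (simp add: s g)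
    qed (auto simp: g s a_ac)
  qed (auto simp: g q s l_distr r_distr m_assoc P.I_l_closed)
qed

lemma (in cring) vectorspace_graded_piece:
  assumes "maximalideal m R"
  shows "vectorspace (R Quot m) (graded_piece R m n)"
  using assms maximalideal.quotient_is_field[OF assms is_cring] module_graded_piece
  by (auto simp: vectorspace_def maximalideal_def)

definition hilbert_function :: "('a, 'b) ring_scheme \<Rightarrow> 'a set \<Rightarrow> nat \<Rightarrow> nat" where
  "hilbert_function R m n = vectorspace.dim (R Quot m) (graded_piece R m n)"

definition hilbert_series :: "('a, 'b) ring_scheme \<Rightarrow> 'a set \<Rightarrow> int fps" where
  "hilbert_series R m = Abs_fps (\<lambda>n. int (hilbert_function R m n))"

end

theory Submission
  imports Defs "HOL-Number_Theory.Cong"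
begin

text \<open>
  Over any field, \<open>m^n/m^(n+1)\<close> has a basis given by the powers \<open>t^s\<close> of those \<open>s\<close> in the semigroup
  for which \<open>n\<close> is the largest number of summands in an expression of \<open>s\<close> as a sum of generators,
  so the Hilbert series is the generating function of this largest number of summands.

  An expression with the largest number of summands, and among these with the fewest summands
  \<open>n1\<close>, cannot be improved by any of the relations between the generators; this puts its exponent
  vector into an explicit set of normal vectors (the complement of the initial ideal of a standard
  basis). Distinct normal vectors have distinct weights: rewriting a normal vector in terms of the
  Apery set \<open>{i n2 + j n3 | i < \<alpha>2, j < \<alpha>3} \<union> {n4}\<close> of \<open>n1\<close>, its weight is congruent to
  \<open>(i \<alpha>3 + j) n3\<close> modulo \<open>n1 = \<alpha>2 \<alpha>3 + 1\<close>, and \<open>n3\<close> is a unit modulo \<open>n1\<close>. So the Hilbert series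
  counts the normal vectors by total degree.
\<close>

subsection \<open>The graded pieces of the semigroup ring\<close>

text \<open>Asking for at least n summands makes this an ideal of the semigroup: the exponents of
  the monomials in the n-th power of the maximal ideal.\<close>

definition semigroup_power :: "nat set \<Rightarrow> nat \<Rightarrow> nat set" where
  "semigroup_power G n = {\<Sum>g\<in>G. u g * g | u. n \<le> sum u G}"

lemma semigroup_power_0: "semigroup_power G 0 = semigroup_gen G"
  by (auto simp: semigroup_power_def semigroup_gen_def)

lemma semigroup_power_antimono: "i \<le> j \<Longrightarrow> semigroup_power G j \<subseteq> semigroup_power G i"
  unfolding semigroup_power_def using le_trans by blast

lemma add_in_semigroup_power:
  assumes "x \<in> semigroup_power G i" "y \<in> semigroup_power G j"
  shows "x + y \<in> semigroup_power G (i + j)"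
proof -
  from assms obtain u v where "x = (\<Sum>g\<in>G. u g * g)" "i \<le> sum u G"
    "y = (\<Sum>g\<in>G. v g * g)" "j \<le> sum v G"
    by (auto simp: semigroup_power_def)
  then show ?thesis
    by (auto simp: semigroup_power_def sum.distrib algebra_simps
        intro!: exI[of _ "\<lambda>g. u g + v g"])
qed

locale positive_generators =
  fixes G :: "nat set"
  assumes finite_G: "finite G" and pos: "0 \<notin> G"
begin

lemma generator_in_semigroup_power: "g \<in> G \<Longrightarrow> g \<in> semigroup_power G (Suc 0)"
  unfolding semigroup_power_def
proof -
  assume "g \<in> G"
  define u where "u h = (if h = g then 1 else 0 :: nat)" for h
  have "(\<Sum>h\<in>G. u h * h) = (\<Sum>h\<in>G. if h = g then h else 0)"
    by (rule sum.cong) (auto simp: u_def)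
  also have "\<dots> = g" using \<open>g \<in> G\<close> finite_G by simp
  finally have "g = (\<Sum>h\<in>G. u h * h)" by simp
  moreover have "Suc 0 \<le> sum u G" using \<open>g \<in> G\<close> finite_G by (simp add: u_def)
  ultimately show "g \<in> {\<Sum>g\<in>G. u g * g |u. Suc 0 \<le> sum u G}" by blast
qed

lemma semigroup_power_SucE:
  assumes "x \<in> semigroup_power G (Suc n)"
  obtains g y where "g \<in> G" "y \<in> semigroup_power G n" "x = y + g"
proof -
  from assms obtain u where u: "x = (\<Sum>g\<in>G. u g * g)" "Suc n \<le> sum u G"
    by (auto simp: semigroup_power_def)
  then have "sum u G \<noteq> 0" by simp
  then obtain g where g: "g \<in> G" "u g \<noteq> 0" by (meson sum.not_neutral_contains_not_neutral)
  define v where "v = u(g := u g - 1)"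
  have "sum u G = u g + sum u (G - {g})" "sum v G = v g + sum v (G - {g})"
    using g finite_G by (simp_all add: sum.remove)
  moreover have "sum v (G - {g}) = sum u (G - {g})" by (auto simp: v_def intro: sum.cong)
  ultimately have "n \<le> sum v G" using u(2) g by (simp add: v_def)
  moreover have "x = (\<Sum>h\<in>G. v h * h) + g"
  proof -
    have "x = u g * g + (\<Sum>h\<in>G - {g}. u h * h)"
      unfolding u using g finite_G by (simp add: sum.remove)
    moreover have "(\<Sum>h\<in>G. v h * h) = v g * g + (\<Sum>h\<in>G - {g}. v h * h)"
      using g finite_G by (simp add: sum.remove)
    moreover have "(\<Sum>h\<in>G - {g}. v h * h) = (\<Sum>h\<in>G - {g}. u h * h)"
      by (auto simp: v_def intro: sum.cong)
    moreover have "u g * g = v g * g + g" using g by (cases "u g") (auto simp: v_def)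
    ultimately show ?thesis by simp
  qed
  ultimately show ?thesis using g that by (auto simp: semigroup_power_def)
qed

lemma zero_notin_semigroup_power: "0 \<notin> semigroup_power G (Suc n)"
  using pos by (metis add_is_0 semigroup_power_SucE)

lemma in_semigroup_power_1: "x \<in> semigroup_gen G \<Longrightarrow> x \<noteq> 0 \<Longrightarrow> x \<in> semigroup_power G (Suc 0)"
proof -
  assume "x \<in> semigroup_gen G" "x \<noteq> 0"
  then obtain u where u: "x = (\<Sum>g\<in>G. u g * g)" "(\<Sum>g\<in>G. u g * g) \<noteq> 0"
    by (auto simp: semigroup_gen_def)
  from u(2) obtain g where "g \<in> G" "u g * g \<noteq> 0" by (meson sum.not_neutral_contains_not_neutral)
  then have "sum u G \<noteq> 0" using finite_G by auto
  then have "Suc 0 \<le> sum u G" by simp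
  with u show "x \<in> semigroup_power G (Suc 0)" unfolding semigroup_power_def by blast
qed

text \<open>No element of the difference has a factorization with more than n summands, so its
  coefficients are at most n and the element is at most \<open>n * \<Sum>G\<close>.\<close>

lemma finite_semigroup_power_diff:
  "finite (semigroup_power G n - semigroup_power G (Suc n))"
proof (rule finite_subset)
  show "semigroup_power G n - semigroup_power G (Suc n) \<subseteq> {..n * \<Sum>G}"
  proof
    fix x assume x: "x \<in> semigroup_power G n - semigroup_power G (Suc n)"
    then obtain u where u: "x = (\<Sum>g\<in>G. u g * g)" "n \<le> sum u G"
      by (auto simp: semigroup_power_def)
    with x have "sum u G = n" unfolding semigroup_power_def using not_less_eq_eq by auto
    then have "u g \<le> n" if "g \<in> G" for g using that finite_G by (metis member_le_sum zero_le)
    then have "x \<le> (\<Sum>g\<in>G. n * g)" unfolding u by (intro sum_mono) auto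
    then show "x \<in> {..n * \<Sum>G}" by (simp add: sum_distrib_left)
  qed
qed simp

section \<open>Powers of the maximal ideal as conditions on the support\<close>

abbreviation R :: "'a::field fps ring" where "R \<equiv> semigroup_ring G"
abbreviation M :: "'a::field fps set" where "M \<equiv> semigroup_max_ideal G"

lemma R_simps: "x \<oplus>\<^bsub>R\<^esub> y = x + y" "x \<otimes>\<^bsub>R\<^esub> y = x * y" "\<one>\<^bsub>R\<^esub> = 1" "\<zero>\<^bsub>R\<^esub> = 0"
  by (simp_all add: semigroup_ring_def)

definition supported :: "nat \<Rightarrow> 'a::field fps set" where
  "supported n = {f. \<forall>i. fps_nth f i \<noteq> 0 \<longrightarrow> i \<in> semigroup_power G n}"

lemma carrier_R: "carrier R = supported 0"
  by (simp add: carrier_semigroup_ring[OF finite_G pos] supported_def semigroup_power_0)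

lemma cring_R: "cring R"
  by (rule cring_semigroup_ring[OF finite_G pos])

lemma supported_antimono: "i \<le> j \<Longrightarrow> supported j \<subseteq> supported i"
  using semigroup_power_antimono unfolding supported_def by blast

lemma supported_subset_carrier: "supported n \<subseteq> carrier R"
  unfolding carrier_R by (rule supported_antimono) simp

lemma supported_0: "0 \<in> supported n"
  by (simp add: supported_def)

lemma supported_add: "x \<in> supported n \<Longrightarrow> y \<in> supported n \<Longrightarrow> x + y \<in> supported n"
  unfolding supported_def by (auto, metis add_0)

lemma supported_uminus: "x \<in> supported n \<Longrightarrow> - x \<in> supported n"
  unfolding supported_def by auto

lemma supported_diff: "x \<in> supported n \<Longrightarrow> y \<in> supported n \<Longrightarrow> x - y \<in> supported n"
  using supported_add[OF _ supported_uminus, of x n y] by simp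

lemma supported_sum: "(\<And>x. x \<in> A \<Longrightarrow> f x \<in> supported n) \<Longrightarrow> sum f A \<in> supported n"
  by (induction A rule: infinite_finite_induct) (auto simp: supported_0 supported_add)

lemma supported_mult: "x \<in> supported i \<Longrightarrow> y \<in> supported j \<Longrightarrow> x * y \<in> supported (i + j)"
  unfolding supported_def
proof (clarsimp)
  fix l
  assume x: "\<forall>l. fps_nth x l \<noteq> 0 \<longrightarrow> l \<in> semigroup_power G i"
    and y: "\<forall>l. fps_nth y l \<noteq> 0 \<longrightarrow> l \<in> semigroup_power G j"
    and "fps_nth (x * y) l \<noteq> 0"
  then obtain h where h: "h \<le> l" "fps_nth x h * fps_nth y (l - h) \<noteq> 0"
    unfolding fps_mult_nth by (meson atLeastAtMost_iff sum.not_neutral_contains_not_neutral)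
  then have "h \<in> semigroup_power G i" "l - h \<in> semigroup_power G j" using x y by auto
  from add_in_semigroup_power[OF this] h show "l \<in> semigroup_power G (i + j)" by simp
qed

lemma supported_const: "fps_const c \<in> supported 0"
  by (auto simp: supported_def semigroup_power_0 zero_in_semigroup_gen)

lemma supported_monomial: "s \<in> semigroup_power G n \<Longrightarrow> fps_const c * fps_X ^ s \<in> supported n"
  by (auto simp: supported_def fps_X_power_iff)

lemma supported_X_power: "s \<in> semigroup_power G n \<Longrightarrow> fps_X ^ s \<in> supported n"
  by (auto simp: supported_def fps_X_power_iff)

text \<open>The terms of f are sorted by exponent: for each i in the support one generator
  \<open>\<sigma> i\<close> is chosen that can be split off, and \<open>h g\<close> collects the
  terms with \<open>\<sigma> i = g\<close>, divided by \<open>fps_X ^ g\<close>. So even an infinite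
  series needs only finitely many products.\<close>

lemma supported_Suc_decomposition:
  assumes f: "f \<in> supported (Suc n)"
  shows "\<exists>h. (\<forall>g\<in>G. h g \<in> supported n) \<and> f = (\<Sum>g\<in>G. h g * fps_X ^ g)"
proof -
  have "\<exists>g. g \<in> G \<and> g \<le> i \<and> i - g \<in> semigroup_power G n" if "i \<in> semigroup_power G (Suc n)" for i
    using semigroup_power_SucE[OF that] by (metis add_diff_cancel_right' le_add2)
  then obtain \<sigma> where \<sigma>: "\<sigma> i \<in> G" "\<sigma> i \<le> i" "i - \<sigma> i \<in> semigroup_power G n"
    if "i \<in> semigroup_power G (Suc n)" for i by metis
  define h where "h g = Abs_fps (\<lambda>i. if \<sigma> (i + g) = g then fps_nth f (i + g) else 0)" for g
  have "h g \<in> supported n" if "g \<in> G" for g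
  proof -
    have "i \<in> semigroup_power G n" if "fps_nth f (i + g) \<noteq> 0" "\<sigma> (i + g) = g" for i
      using that f \<sigma>(3)[of "i + g"] by (auto simp: supported_def)
    then show ?thesis by (auto simp: supported_def h_def)
  qed
  moreover have "f = (\<Sum>g\<in>G. h g * fps_X ^ g)"
  proof (rule fps_ext)
    fix i
    have "fps_nth (\<Sum>g\<in>G. h g * fps_X ^ g) i
        = (\<Sum>g\<in>G. if g \<le> i \<and> \<sigma> i = g then fps_nth f i else 0)"
      by (auto simp: fps_sum_nth fps_X_power_mult_right_nth h_def intro!: sum.cong)
    also have "\<dots> = fps_nth f i"
    proof (cases "fps_nth f i = 0")
      case False
      then have "i \<in> semigroup_power G (Suc n)" using f by (auto simp: supported_def)
      from \<sigma>[OF this] have "(\<Sum>g\<in>G. if g \<le> i \<and> \<sigma> i = g then fps_nth f i else 0)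
          = (\<Sum>g\<in>G. if \<sigma> i = g then fps_nth f i else 0)" by (intro sum.cong) auto
      then show ?thesis using \<sigma>(1)[OF \<open>i \<in> _\<close>] finite_G by simp
    qed (auto intro: sum.neutral)
    finally show "fps_nth f i = fps_nth (\<Sum>g\<in>G. h g * fps_X ^ g) i" by simp
  qed
  ultimately show ?thesis by blast
qed

lemma ideal_supported: "ideal (supported n) (R :: 'a::field fps ring)"
proof -
  interpret cring "R :: 'a fps ring" by (rule cring_R)
  show ?thesis
  proof (rule idealI)
    show "subgroup (supported n) (add_monoid (R :: 'a fps ring))"
    proof (rule subgroup.intro)
      fix x :: "'a fps" assume x: "x \<in> supported n"
      then have "\<ominus>\<^bsub>R\<^esub> x = - x"
        using supported_subset_carrier supported_uminus
        by (intro minus_equality) (auto simp: R_simps)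
      then show "inv\<^bsub>add_monoid R\<^esub> x \<in> supported n"
        using supported_uminus[OF x] by (simp add: a_inv_def)
    qed (use supported_subset_carrier in \<open>auto simp: R_simps supported_0 supported_add\<close>)
  qed (use supported_mult[of _ n _ 0] supported_mult[of _ 0 _ n] in
      \<open>auto simp: R_simps carrier_R intro: ring_axioms\<close>)
qed

lemma sum_in_ideal:
  assumes "ideal I R" "\<And>x. x \<in> A \<Longrightarrow> f x \<in> I"
  shows "sum f A \<in> I"
proof -
  interpret ideal I R by fact
  show ?thesis
    using assms(2) additive_subgroup.zero_closed[OF is_additive_subgroup]
      additive_subgroup.a_closed[OF is_additive_subgroup]
    by (induction A rule: infinite_finite_induct) (auto simp: R_simps)
qed

lemma M_eq_supported: "M = (supported (Suc 0) :: 'a::field fps set)"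
proof
  interpret cring "R :: 'a fps ring" by (rule cring_R)
  have gens: "(\<lambda>g. fps_X ^ g :: 'a fps) ` G \<subseteq> supported (Suc 0)"
    using generator_in_semigroup_power supported_X_power by blast
  show "(M :: 'a fps set) \<subseteq> supported (Suc 0)"
    unfolding semigroup_max_ideal_def by (rule genideal_minimal[OF ideal_supported gens])
  have gc: "(\<lambda>g. fps_X ^ g :: 'a fps) ` G \<subseteq> carrier R"
    using gens supported_subset_carrier by blast
  interpret M: ideal M "R :: 'a fps ring" unfolding semigroup_max_ideal_def by (rule genideal_ideal[OF gc])
  show "supported (Suc 0) \<subseteq> (M :: 'a fps set)"
  proof
    fix f :: "'a fps" assume "f \<in> supported (Suc 0)"
    then obtain h where h: "\<And>g. g \<in> G \<Longrightarrow> h g \<in> supported 0" "f = (\<Sum>g\<in>G. h g * fps_X ^ g)"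
      using supported_Suc_decomposition by blast
    show "f \<in> M" unfolding h(2)
    proof (rule sum_in_ideal[OF M.ideal_axioms])
      fix g assume g: "g \<in> G"
      have "(fps_X ^ g :: 'a fps) \<in> M"
        unfolding semigroup_max_ideal_def by (rule subsetD[OF genideal_self[OF gc] imageI[OF g]])
      then show "h g * fps_X ^ g \<in> M"
        using M.I_l_closed[of _ "h g"] h(1)[OF g] by (simp add: R_simps carrier_R)
    qed
  qed
qed

lemma ideal_power_M: "ideal_power R M n = (supported n :: 'a::field fps set)"
proof (induction n)
  case 0
  then show ?case by (simp add: carrier_R)
next
  case (Suc n)
  interpret cring "R :: 'a fps ring" by (rule cring_R)
  have "f \<in> supported (Suc n)" if "f \<in> ideal_prod R (supported n) (supported (Suc 0))" for f :: "'a fps"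
    using that
    by induction (use supported_mult[of _ n _ "Suc 0"] in \<open>auto simp: R_simps supported_add\<close>)
  moreover have "f \<in> ideal_prod R (supported n) (supported (Suc 0))" if f: "f \<in> supported (Suc n)" for f :: "'a fps"
  proof -
    obtain h where h: "\<And>g. g \<in> G \<Longrightarrow> h g \<in> supported n" "f = (\<Sum>g\<in>G. h g * fps_X ^ g)"
      using supported_Suc_decomposition[OF f] by blast
    have "ideal (ideal_prod R (supported n) (supported (Suc 0))) (R :: 'a fps ring)"
      by (intro ideal_prod_is_ideal ideal_supported)
    then show ?thesis unfolding h(2)
    proof (rule sum_in_ideal)
      fix g assume "g \<in> G"
      then have "h g \<in> supported n" "fps_X ^ g \<in> supported (Suc 0)"
        using h supported_X_power generator_in_semigroup_power by blast+
      from ideal_prod.prod[OF this, of R]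
      show "h g * fps_X ^ g \<in> ideal_prod R (supported n) (supported (Suc 0))"
        by (simp add: R_simps)
    qed
  qed
  ultimately show ?case using Suc by (auto simp: M_eq_supported)
qed

lemma minus_const_supported: "f \<in> supported 0 \<Longrightarrow> f - fps_const (fps_nth f 0) \<in> supported (Suc 0)"
  using in_semigroup_power_1 by (auto simp: supported_def semigroup_power_0)

text \<open>An element of the ring outside M has nonzero constant term, and the rest of it lies in
  M. An ideal containing M and this element therefore contains a nonzero constant, which is a
  unit.\<close>

lemma maximalideal_M: "maximalideal M (R :: 'a::field fps ring)"
proof -
  interpret cring "R :: 'a fps ring" by (rule cring_R)
  show ?thesis
  proof (rule maximalidealI)
    show "ideal M (R :: 'a fps ring)" unfolding M_eq_supported by (rule ideal_supported)
    have "1 \<in> carrier (R :: 'a fps ring)" "1 \<notin> (supported (Suc 0) :: 'a fps set)"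
      using one_closed zero_notin_semigroup_power[of 0] by (auto simp: R_simps supported_def)
    then show "carrier R \<noteq> (M :: 'a fps set)" unfolding M_eq_supported by blast
    fix J :: "'a fps set"
    assume J: "ideal J R" "M \<subseteq> J" "J \<subseteq> carrier R"
    interpret J: ideal J R by fact
    show "J = M \<or> J = carrier R"
    proof (cases "J \<subseteq> M")
      case False
      then obtain f where f: "f \<in> J" "f \<notin> supported (Suc 0)" by (auto simp: M_eq_supported)
      then have f0: "f \<in> supported 0" using J(3) by (auto simp: carrier_R)
      then have d: "f - fps_const (fps_nth f 0) \<in> supported (Suc 0)" by (rule minus_const_supported)
      with f have nz: "fps_nth f 0 \<noteq> 0" by auto
      have "- (f - fps_const (fps_nth f 0)) \<in> J"
        using supported_uminus[OF d] J(2) by (simp only: M_eq_supported subset_iff)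
      from J.a_closed[OF f(1) this] have "fps_const (fps_nth f 0) \<in> J"
        by (simp add: R_simps)
      from J.I_l_closed[OF this, of "fps_const (inverse (fps_nth f 0))"] nz
      have "\<one>\<^bsub>R\<^esub> \<in> J" by (simp add: R_simps carrier_R supported_const)
      then show ?thesis using J.one_imp_carrier by blast
    qed (use J in blast)
  qed
qed

section \<open>Graded pieces and their monomial bases\<close>

lemma coset_eq: "supported n +>\<^bsub>R\<^esub> x = {f. f - x \<in> supported n}"
proof -
  have "f = (f - x) + x" for f :: "'a fps" by simp
  then show ?thesis by (auto simp: a_r_coset_def' R_simps) 
qed

lemma coset_eq_iff: "supported n +>\<^bsub>R\<^esub> x = supported n +>\<^bsub>R\<^esub> y \<longleftrightarrow> x - y \<in> supported n"
proof
  assume "supported n +>\<^bsub>R\<^esub> x = supported n +>\<^bsub>R\<^esub> y"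
  moreover have "x \<in> supported n +>\<^bsub>R\<^esub> x" by (simp add: coset_eq supported_0)
  ultimately show "x - y \<in> supported n" by (auto simp: coset_eq)
next
  assume "x - y \<in> supported n"
  then show "supported n +>\<^bsub>R\<^esub> x = supported n +>\<^bsub>R\<^esub> y"
    unfolding coset_eq using supported_add[of "_ - x" n "x - y"] supported_diff[of "_ - y" n "x - y"]
    by fastforce
qed

lemma graded_piece_simps:
  "carrier (graded_piece R M n) = (\<lambda>x. supported (Suc n) +>\<^bsub>R\<^esub> x) ` supported n"
  "\<zero>\<^bsub>graded_piece R M n\<^esub> = supported (Suc n)"
  by (simp_all add: graded_piece_def Let_def ideal_power_M del: ideal_power.simps)

lemma graded_piece_add:
  "(supported (Suc n) +>\<^bsub>R\<^esub> (x :: 'a::field fps)) \<oplus>\<^bsub>graded_piece R M n\<^esub> (supported (Suc n) +>\<^bsub>R\<^esub> y) =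
     supported (Suc n) +>\<^bsub>R\<^esub> (x + y)" (is "?l = ?r")
  if "x \<in> supported n" "y \<in> supported n"
proof -
  interpret cring "R :: 'a fps ring" by (rule cring_R)
  interpret ideal "supported (Suc n)" "R :: 'a fps ring" by (rule ideal_supported)
  have "?l = set_add R (supported (Suc n) +>\<^bsub>R\<^esub> x) (supported (Suc n) +>\<^bsub>R\<^esub> y)"
    by (simp add: graded_piece_def Let_def ideal_power_M del: ideal_power.simps)
  also have "\<dots> = ?r"
    using a_rcos_sum[of x y] subsetD[OF supported_subset_carrier that(1)]
      subsetD[OF supported_subset_carrier that(2)] by (simp add: R_simps)
  finally show ?thesis .
qed

lemma graded_piece_smult_const:
  assumes "x \<in> supported n"
  shows "(M +>\<^bsub>R\<^esub> fps_const (c :: 'a::field)) \<odot>\<^bsub>graded_piece R M n\<^esub> (supported (Suc n) +>\<^bsub>R\<^esub> x) =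
     supported (Suc n) +>\<^bsub>R\<^esub> (fps_const c * x)" (is "?l = ?r")
proof -
  interpret cring "R :: 'a fps ring" by (rule cring_R)
  have M_ideal: "ideal M (R :: 'a fps ring)"
    unfolding M_eq_supported by (rule ideal_supported)
  have "?l = rcoset_mult R (ideal_power R M (Suc n)) (M +>\<^bsub>R\<^esub> fps_const c)
                 (ideal_power R M (Suc n) +>\<^bsub>R\<^esub> x)"
    by (simp add: graded_piece_def Let_def ideal_power_M del: ideal_power.simps)
  also have "\<dots> = ideal_power R M (Suc n) +>\<^bsub>R\<^esub> (fps_const c \<otimes>\<^bsub>R\<^esub> x)"
    using assms supported_const
    by (intro graded_piece_smult) (simp_all add: M_ideal ideal_power_M carrier_R)
  finally show ?thesis by (simp add: R_simps ideal_power_M del: ideal_power.simps)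
qed

text \<open>The residue field is the ground field, so linear combinations in a graded piece can be
  computed with constant coefficients.\<close>

lemma residue_field_constant:
  assumes "a \<in> carrier (R Quot M)"
  shows "\<exists>c. a = M +>\<^bsub>R\<^esub> fps_const c"
proof -
  obtain f where f: "f \<in> supported 0" "a = M +>\<^bsub>R\<^esub> f"
    using assms by (auto simp: FactRing_def A_RCOSETS_def' carrier_R)
  then show ?thesis
    using minus_const_supported[of f] by (auto simp: coset_eq_iff M_eq_supported)
qed

text \<open>Coefficients at exponents in \<open>D\<close> vanish on \<open>J\<close>, hence are well
  defined on cosets; this gives independence. Removing from a series in \<open>supported n\<close>
  its terms with exponents in \<open>D\<close> leaves an element of \<open>J\<close>; this gives
  spanning.\<close>

theorem hilbert_function_semigroup_ring:
  "hilbert_function (R :: 'a::field fps ring) M n =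
     card (semigroup_power G n - semigroup_power G (Suc n))"
proof -
  define D where "D = semigroup_power G n - semigroup_power G (Suc n)"
  define J :: "'a fps set" where "J = supported (Suc n)"
  define b :: "nat \<Rightarrow> 'a fps set" where "b s = J +>\<^bsub>R\<^esub> fps_X ^ s" for s
  define V where "V = graded_piece (R :: 'a fps ring) M n"
  interpret cring "R :: 'a fps ring" by (rule cring_R)
  interpret V: vectorspace "R Quot M" V
    unfolding V_def by (rule vectorspace_graded_piece[OF maximalideal_M])
  have fD: "finite D" unfolding D_def by (rule finite_semigroup_power_diff)
  have X: "(fps_X ^ s :: 'a fps) \<in> supported n" if "s \<in> D" for s
    using that supported_X_power by (auto simp: D_def)
  have nth_D: "fps_nth f s = 0" if "s \<in> D" "f \<in> J" for f s
    using that by (auto simp: D_def J_def supported_def)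
  have J0: "J = J +>\<^bsub>R\<^esub> 0" by (simp add: J_def coset_eq)
  have V0: "\<zero>\<^bsub>V\<^esub> = J" by (simp add: V_def graded_piece_simps J_def)
  have J_iff: "J +>\<^bsub>R\<^esub> f = J \<longleftrightarrow> f \<in> J" for f
    using coset_eq_iff[of "Suc n" f 0] J0 by (simp add: J_def)
  have bV: "b s \<in> carrier V" if "s \<in> D" for s
    using X[OF that] by (simp add: b_def V_def graded_piece_simps J_def)
  have b_inj: "inj_on b D"
  proof (rule inj_onI, rule ccontr)
    fix s t assume st: "s \<in> D" "t \<in> D" "b s = b t" "s \<noteq> t"
    then have "fps_X ^ s - fps_X ^ t \<in> J" by (simp add: b_def J_def coset_eq_iff)
    from nth_D[OF st(1) this] st(4) show False by (simp add: fps_X_power_iff)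
  qed
  define P :: "(nat \<Rightarrow> 'a) \<Rightarrow> 'a fps" where "P c = (\<Sum>s\<in>D. fps_const (c s) * fps_X ^ s)" for c
  have nth_P: "fps_nth (P c) s = (if s \<in> D then c s else 0)" for c s
  proof -
    have "fps_nth (P c) s = (\<Sum>t\<in>D. if s = t then c t else 0)"
      by (auto simp: P_def fps_sum_nth fps_X_power_iff intro!: sum.cong)
    then show ?thesis using fD by simp
  qed
  have lincomb: "V.module.lincomb a (b ` D) = J +>\<^bsub>R\<^esub> P c"
    if c: "\<And>s. s \<in> D \<Longrightarrow> a (b s) = M +>\<^bsub>R\<^esub> fps_const (c s)" for a c
  proof -
    have t: "a (b s) \<odot>\<^bsub>V\<^esub> b s = J +>\<^bsub>R\<^esub> (fps_const (c s) * fps_X ^ s)" if "s \<in> D" for s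
      using graded_piece_smult_const[OF X[OF that], of "c s"] c[OF that]
      by (simp add: V_def b_def J_def)
    have cX: "fps_const (c s) * fps_X ^ s \<in> supported n" if "s \<in> D" for s
      using that supported_monomial by (auto simp: D_def)
    have tV: "a (b s) \<odot>\<^bsub>V\<^esub> b s \<in> carrier V" if "s \<in> D" for s
      using cX[OF that] t[OF that] by (simp add: V_def graded_piece_simps J_def)
    have "(\<Oplus>\<^bsub>V\<^esub>s\<in>E. a (b s) \<odot>\<^bsub>V\<^esub> b s) = J +>\<^bsub>R\<^esub> (\<Sum>s\<in>E. fps_const (c s) * fps_X ^ s)"
      if "E \<subseteq> D" for E
      using finite_subset[OF that fD] that
    proof (induction E rule: finite_induct)
      case empty
      then show ?case using J0 V0 by simp
    next
      case (insert s E)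
      then have "(\<Oplus>\<^bsub>V\<^esub>s\<in>insert s E. a (b s) \<odot>\<^bsub>V\<^esub> b s)
          = a (b s) \<odot>\<^bsub>V\<^esub> b s \<oplus>\<^bsub>V\<^esub> (\<Oplus>\<^bsub>V\<^esub>s\<in>E. a (b s) \<odot>\<^bsub>V\<^esub> b s)"
        using tV by (intro V.module.M.finsum_insert) auto
      also have "\<dots> = J +>\<^bsub>R\<^esub> (\<Sum>s\<in>insert s E. fps_const (c s) * fps_X ^ s)"
        using insert t cX unfolding V_def J_def
        by (simp add: graded_piece_add supported_sum subset_iff)
      finally show ?case .
    qed
    from this[of D] have "(\<Oplus>\<^bsub>V\<^esub>s\<in>D. a (b s) \<odot>\<^bsub>V\<^esub> b s) = J +>\<^bsub>R\<^esub> P c" by (simp add: P_def)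
    moreover have "(\<Oplus>\<^bsub>V\<^esub>v\<in>b ` D. a v \<odot>\<^bsub>V\<^esub> v) = (\<Oplus>\<^bsub>V\<^esub>s\<in>D. a (b s) \<odot>\<^bsub>V\<^esub> b s)"
      using tV b_inj by (intro V.module.M.finsum_reindex) auto
    ultimately show ?thesis by (simp add: V.module.lincomb_def)
  qed
  have "V.basis (b ` D)"
    unfolding V.basis_def
  proof (intro conjI)
    show bc: "b ` D \<subseteq> carrier V" using bV by auto
    show "V.module.lin_indpt (b ` D)"
    proof (rule V.module.finite_lin_indpt2)
      fix a assume a: "a \<in> b ` D \<rightarrow> carrier (R Quot M)" "V.module.lincomb a (b ` D) = \<zero>\<^bsub>V\<^esub>"
      have "\<exists>c. a (b s) = M +>\<^bsub>R\<^esub> fps_const c" if "s \<in> D" for s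
        using a(1) that by (intro residue_field_constant) auto
      then obtain c where c: "a (b s) = M +>\<^bsub>R\<^esub> fps_const (c s)" if "s \<in> D" for s
        by metis
      have "J +>\<^bsub>R\<^esub> P c = \<zero>\<^bsub>V\<^esub>" by (rule trans[OF sym[OF lincomb[of a c, OF c]] a(2)])
      then have "P c \<in> J" unfolding V0 J_iff .
      then have c0: "c s = 0" if "s \<in> D" for s using nth_D[OF that] nth_P[of c s] that by simp
      have "M +>\<^bsub>R\<^esub> (0 :: 'a fps) = \<zero>\<^bsub>R Quot M\<^esub>"
        by (simp add: FactRing_def M_eq_supported coset_eq)
      then show "\<forall>v\<in>b ` D. a v = \<zero>\<^bsub>R Quot M\<^esub>" using c c0 by auto
    qed (use fD bc in auto)
    show "V.module.gen_set (b ` D)"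
    proof
      show "V.module.span (b ` D) \<subseteq> carrier V"
        using bc by (rule V.module.span_is_subset2)
      show "carrier V \<subseteq> V.module.span (b ` D)"
      proof
        fix v assume "v \<in> carrier V"
        then obtain f where f: "f \<in> supported n" "v = J +>\<^bsub>R\<^esub> f"
          by (auto simp: V_def graded_piece_simps J_def)
        define c where "c = fps_nth f"
        \<comment> \<open>A coefficient function takes vectors, not exponents, as arguments; the
          inverse of \<open>b\<close> on \<open>D\<close> recovers the exponent.\<close>
        define a where "a v = M +>\<^bsub>R\<^esub> fps_const (c (the_inv_into D b v))" for v
        have "f - P c \<in> J"
          using f(1) by (auto simp: J_def supported_def nth_P c_def D_def)
        then have "v = J +>\<^bsub>R\<^esub> P c" unfolding J_def f(2) coset_eq_iff .
        also have "\<dots> = V.module.lincomb a (b ` D)"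
          by (rule lincomb[symmetric]) (simp add: a_def the_inv_into_f_f[OF b_inj])
        finally have "v = V.module.lincomb a (b ` D)" .
        moreover have "a \<in> b ` D \<rightarrow> carrier (R Quot M)"
          unfolding a_def FactRing_def A_RCOSETS_def' carrier_R using supported_const by fastforce
        ultimately show "v \<in> V.module.span (b ` D)"
          using fD bc by (auto simp: V.module.finite_span)
      qed
    qed
  qed
  then have "V.dim = card (b ` D)" using fD by (intro V.dim_basis) auto
  then show ?thesis
    using b_inj by (simp add: hilbert_function_def V_def D_def card_image)
qed

end

subsection \<open>Generating functions\<close>

definition support_series :: "nat set \<Rightarrow> int fps" where
  "support_series A = Abs_fps (\<lambda>n. of_bool (n \<in> A))"

lemma support_series_UNIV: "support_series UNIV * (1 - fps_X) = 1"
  by (rule fps_ext) (auto simp: support_series_def algebra_simps fps_X_mult_right_nth)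

lemma support_series_lessThan: "support_series {..<m} * (1 - fps_X) = 1 - fps_X ^ m"
  by (rule fps_ext) (auto simp: support_series_def algebra_simps fps_X_power_iff fps_X_mult_right_nth)

text \<open>For fixed n the first entry must be \<open>n - d t\<close>, so the pairs are counted by
  t alone, and each t contributes the series of \<open>A t\<close> shifted by
  \<open>d t\<close>.\<close>

lemma fibre_series_Sigma:
  assumes "finite T"
  shows "Abs_fps (\<lambda>n. int (card {(x, t). t \<in> T \<and> x \<in> A t \<and> x + d t = n})) =
     (\<Sum>t\<in>T. support_series (A t) * fps_X ^ d t)"
proof (rule fps_ext)
  fix n
  have "{(x, t). t \<in> T \<and> x \<in> A t \<and> x + d t = n} =
      (\<lambda>t. (n - d t, t)) ` {t \<in> T. d t \<le> n \<and> n - d t \<in> A t}"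
    by (auto simp: image_iff)
  then have "card {(x, t). t \<in> T \<and> x \<in> A t \<and> x + d t = n} = card {t \<in> T. d t \<le> n \<and> n - d t \<in> A t}"
    by (simp add: card_image inj_on_def)
  also have "int \<dots> = (\<Sum>t\<in>T. of_bool (d t \<le> n \<and> n - d t \<in> A t))"
    using assms by (simp add: sum_of_bool_eq Int_def conj_ac)
  also have "\<dots> = fps_nth (\<Sum>t\<in>T. support_series (A t) * fps_X ^ d t) n"
    by (auto simp: fps_sum_nth fps_X_power_mult_right_nth support_series_def intro!: sum.cong)
  finally show "fps_nth (Abs_fps (\<lambda>n. int (card {(x, t). t \<in> T \<and> x \<in> A t \<and> x + d t = n}))) n =
      fps_nth (\<Sum>t\<in>T. support_series (A t) * fps_X ^ d t) n" by simp
qed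

subsection \<open>Normal forms of factorizations\<close>

type_synonym exponents = "nat \<times> nat \<times> nat \<times> nat"

fun total_degree :: "exponents \<Rightarrow> nat" where
  "total_degree (x, i, j, l) = x + i + j + l"

text \<open>The parameters are \<open>a = \<alpha>1\<close>, \<open>b = \<alpha>2\<close>, \<open>c = \<alpha>3\<close>, \<open>e = \<alpha>21\<close> and \<open>h = \<alpha>1 - \<alpha>21 - 1\<close>, with \<open>\<alpha>4 = 2\<close>.\<close>

locale komeda_semigroup =
  fixes a b c e h k n1 n2 n3 n4 :: nat
  assumes a: "a = e + h + 1" and e: "0 < e" and h: "0 < h"
    and b: "e + 1 < b" and c: "1 < c"
    and n1: "n1 = b * c + 1"
    and less12: "n1 < n2" and less23: "n2 < n3" and less34: "n3 < n4"
    and coprime13: "coprime n1 n3"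
    and relation1: "a * n1 = n3 + n4"
    and relation2: "b * n2 = e * n1 + n4"
    and relation3: "c * n3 = h * n1 + n2"
    and k_pos: "0 < k"
    and k: "k * (b + 1) < (k - 1) * a + (k + 1) * e + c"
    and k_least: "\<And>j. 0 < j \<Longrightarrow> j * (b + 1) < (j - 1) * a + (j + 1) * e + c \<Longrightarrow> k \<le> j"
begin

section \<open>Relations among the generators and bounds on the parameters\<close>

fun weight :: "exponents \<Rightarrow> nat" where
  "weight (x, i, j, l) = x * n1 + i * n2 + j * n3 + l * n4"

text \<open>For 0 < q \<le> c the inequality that defines k reads
  \<open>q * b + 1 < p q + (c - q)\<close>. So k is the first q for which
  \<open>X2 ^ (q * b + 1)\<close> has smaller degree than \<open>X1 ^ p q * X3 ^ (c - q)\<close>;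
  for q < k the second monomial is taken as the leading one.\<close>

definition p :: "nat \<Rightarrow> nat" where
  "p q = (q - 1) * a + (q + 1) * e + 1"

text \<open>Compares the weights in \<open>X4 ^ 2 - X1 * X2 ^ (b - 1) * X3 ^ (c - 1)\<close>, with
  n2 + n3 added on both sides to avoid subtraction. \<open>relation5\<close> treats
  \<open>X1 ^ (e + 1) * X3 ^ (c - 1) - X2 * X4\<close> likewise, adding n3.\<close>

lemma relation4: "2 * n4 + n2 + n3 = n1 + b * n2 + c * n3"
proof -
  have "n1 + b * n2 + c * n3 = a * n1 + n2 + n4"
    by (simp add: relation2 relation3 a algebra_simps)
  then show ?thesis by (simp add: relation1)
qed

lemma relation5: "(e + 1) * n1 + c * n3 = n2 + n3 + n4"
proof -
  have "(e + 1) * n1 + c * n3 = a * n1 + n2" by (simp add: relation3 a algebra_simps)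
  then show ?thesis by (simp add: relation1)
qed

text \<open>The remaining elements of a standard basis: \<open>X2 ^ (q b + 1) - X1 ^ p q * X3 ^ (c - q)\<close>.\<close>

lemma relation_p:
  assumes "0 < q"
  shows "(q * b + 1) * n2 + q * n3 = p q * n1 + c * n3"
proof -
  obtain r where q: "q = Suc r" using assms by (cases q) auto
  \<comment> \<open>Eliminating n4 from \<open>relation1\<close> and \<open>relation2\<close> gives
    \<open>b * n2 + n3 = (e + a) * n1\<close>. This is taken q times; \<open>relation3\<close> then
    supplies one further n2.\<close>
  have "q * (b * n2) + q * n3 = q * (e * n1 + a * n1)"
    by (simp add: relation2 relation1 algebra_simps)
  moreover have "p q * n1 + c * n3 = q * (e * n1 + a * n1) + n2"
    unfolding p_def q by (simp add: relation3 a algebra_simps)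
  ultimately show ?thesis by (simp add: algebra_simps)
qed

text \<open>As n1 and n2 are below n3, \<open>relation3\<close> forces
  \<open>c * n3 < (h + 1) * n3\<close>. Hence replacing \<open>X3 ^ c\<close> by
  \<open>X1 ^ h * X2\<close> raises the degree.\<close>

lemma c_le_h: "c \<le> h"
proof -
  have "h * n1 + n2 < (h + 1) * n3"
  proof -
    have "h * n1 \<le> h * n3" using less12 less23 by (intro mult_le_mono2) simp
    then have "h * n1 + n2 < h * n3 + n3" using less23 by linarith
    then show ?thesis by simp
  qed
  then have "c * n3 < (h + 1) * n3" unfolding relation3 .
  then have "c < h + 1" unfolding mult_less_cancel2 by blast
  then show ?thesis by simp
qed

text \<open>For q = c the variable X3 disappears from \<open>relation_p\<close>, and n1 < n2
  compares the two exponents that remain. So c satisfies the inequality of which k is the least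
  solution.\<close>

lemma k_le_c: "k \<le> c"
proof (rule k_least)
  have "(c * b + 1) * n2 = p c * n1" using relation_p[of c] c by simp
  also have "\<dots> < p c * n2" using less12 by (intro mult_strict_left_mono) (auto simp: p_def)
  finally have "c * b + 1 < p c" unfolding mult_less_cancel2 by blast
  then show "c * (b + 1) < (c - 1) * a + (c + 1) * e + c" by (simp add: p_def)
qed (use c in simp)

text \<open>The inequality for k, with \<open>e + c\<close> estimated by a, becomes k times the
  claim. It says that \<open>X2 ^ b * X3\<close> has smaller degree than
  \<open>X1 ^ (a + e)\<close>.\<close>

lemma b_bound: "b + 1 < a + e"
proof -
  have "c < a" using c_le_h a by simp
  have "k * (b + 1) < (k - 1) * a + (k + 1) * e + c" by (rule k)
  also have "\<dots> = k * e + (k - 1) * a + e + c" by (simp add: algebra_simps)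
  also have "\<dots> \<le> k * e + (k - 1) * a + a" using c_le_h a by simp
  also have "\<dots> = k * (a + e)" using k_pos by (cases k) (simp_all add: algebra_simps)
  finally have "k * (b + 1) < k * (a + e)" .
  then show ?thesis unfolding nat_mult_less_cancel1[OF k_pos] .
qed

section \<open>Existence of normal factorizations\<close>

text \<open>The monomials divisible by none of \<open>X4 ^ 2\<close>, \<open>X2 * X4\<close>,
  \<open>X3 * X4\<close>, \<open>X1 ^ e * X4\<close>, \<open>X3 ^ c\<close>,
  \<open>X2 ^ b * X3\<close>, \<open>X2 ^ (k * b + 1)\<close> and
  \<open>X1 ^ p q * X3 ^ (c - q)\<close> for 0 < q < k. Since p increases, testing
  \<open>q = c - j\<close> suffices.\<close>

definition normal :: "exponents set" where
  "normal = {(x, 0, 0, 1) | x. x < e} \<union> {(x, i, 0, 0) | x i. i \<le> k * b} \<union>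
     {(x, i, j, 0) | x i j. 0 < j \<and> j < c \<and> i < b \<and> (c - j < k \<longrightarrow> x < p (c - j))}"

lemma exists_normal:
  obtains v where "v \<in> normal" "weight v = weight u" "total_degree u \<le> total_degree v"
proof -
  define W where "W = weight u"
  \<comment> \<open>Encodes a lexicographic order: large degree first, then small exponent of X1.
    The factor \<open>W + 1\<close> exceeds \<open>W - fst v\<close>, and that subtraction is exact
    because no exponent in a vector of weight W exceeds W.\<close>
  define \<mu> where "\<mu> v = total_degree v * (W + 1) + (W - fst v)" for v
  define Q where "Q v \<longleftrightarrow> weight v = W \<and> total_degree u \<le> total_degree v" for v
  have n: "0 < n1" "0 < n2" "0 < n3" using n1 less12 less23 by auto
  have "e * n1 < b * n2" using less12 b n by (intro mult_less_le_imp_less) auto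
  then have n4: "0 < n4" using relation2 by simp
  have degree_le: "total_degree v \<le> W" if "weight v = W" for v
  proof -
    obtain x i j l where v: "v = (x, i, j, l)" by (cases v)
    have "x \<le> x * n1" "i \<le> i * n2" "j \<le> j * n3" "l \<le> l * n4" using n n4 by simp_all
    moreover have "x * n1 + i * n2 + j * n3 + l * n4 = W" using that by (simp add: v)
    ultimately show ?thesis unfolding v total_degree.simps by linarith
  qed
  have "\<mu> v < (W + 1) * (W + 1)" if "Q v" for v
  proof -
    have "total_degree v * (W + 1) \<le> W * (W + 1)"
      using degree_le that by (intro mult_le_mono1) (auto simp: Q_def)
    then show ?thesis by (simp add: \<mu>_def)
  qed
  moreover have "Q u" by (simp add: Q_def W_def)
  ultimately obtain v where v: "Q v" "\<And>w. Q w \<Longrightarrow> \<mu> w \<le> \<mu> v"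
    using ex_has_greatest_nat[of Q u \<mu> "(W + 1) * (W + 1)"] by blast
  obtain x i j l where xijl: "v = (x, i, j, l)" by (cases v)
  have wt: "x * n1 + i * n2 + j * n3 + l * n4 = W" using v(1) by (simp add: Q_def xijl)
  have degree_maximal: "total_degree w \<le> x + i + j + l" if "weight w = W" for w
  proof (rule ccontr)
    assume *: "\<not> ?thesis"
    then have "\<mu> w \<le> \<mu> v" using that v by (auto simp: Q_def xijl)
    moreover have "(x + i + j + l + 1) * (W + 1) \<le> total_degree w * (W + 1)"
      using * by (intro mult_le_mono1) simp
    ultimately show False by (simp add: \<mu>_def xijl)
  qed
  have first_minimal: "x \<le> fst w" if "weight w = W" "x + i + j + l \<le> total_degree w" for w
  proof -
    have "total_degree w = x + i + j + l" using degree_maximal that by (simp add: le_antisym)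
    moreover from this have "\<mu> w \<le> \<mu> v" using that v by (auto simp: Q_def xijl)
    moreover have "x \<le> W" using degree_le[of v] v(1) by (simp add: Q_def xijl)
    ultimately show ?thesis by (simp add: \<mu>_def xijl)
  qed
  \<comment> \<open>Each block from here to \<open>i_le\<close> excludes one monomial, starting with
    \<open>X4 ^ 2\<close>: a relation would replace it by a monomial of larger degree.\<close>
  have l1: "l \<le> 1"
  proof (rule ccontr)
    assume "\<not> ?thesis"
    then obtain m where m: "l = m + 2" by (metis add.commute le_add_diff_inverse not_less_eq_eq one_add_one plus_1_eq_Suc)
    have "weight (x + 1, i + (b - 1), j + (c - 1), m) = W"
    proof -
      have "weight (x + 1, i + (b - 1), j + (c - 1), m) + n2 + n3
        = x * n1 + i * n2 + j * n3 + m * n4 + (n1 + b * n2 + c * n3)"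
        using b c by (cases b; cases c) (auto simp: algebra_simps)
      then show ?thesis using wt relation4 by (simp add: m algebra_simps)
    qed
    from degree_maximal[OF this] show False using b c e by (simp add: m)
  qed
  have l_i: "i = 0" if "l = 1"
  proof (rule ccontr)
    assume "i \<noteq> 0"
    then obtain m where m: "i = Suc m" by (cases i) auto
    have "weight (x + e + 1, m, j + (c - 1), 0) = W"
    proof -
      have "weight (x + e + 1, m, j + (c - 1), 0) + n3
        = x * n1 + m * n2 + j * n3 + ((e + 1) * n1 + c * n3)"
        using c by (cases c) (auto simp: algebra_simps)
      then show ?thesis using wt relation5 that by (simp add: m algebra_simps)
    qed
    from degree_maximal[OF this] show False using c e that by (simp add: m)
  qed
  have l_j: "j = 0" if "l = 1"
  proof (rule ccontr)
    assume "j \<noteq> 0"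
    then obtain m where m: "j = Suc m" by (cases j) auto
    have "weight (x + a, i, m, 0) = W"
      using wt relation1 that by (simp add: m algebra_simps)
    from degree_maximal[OF this] show False using a e h that by (simp add: m)
  qed
  have l_x: "x < e" if "l = 1"
  proof (rule ccontr)
    assume "\<not> ?thesis"
    then obtain m where m: "x = e + m" by (metis le_Suc_ex not_less)
    have "weight (m, i + b, j, 0) = W"
      using wt relation2 that by (simp add: m algebra_simps)
    from degree_maximal[OF this] show False using b that by (simp add: m)
  qed
  have j_less: "j < c"
  proof (rule ccontr)
    assume "\<not> ?thesis"
    then obtain m where m: "j = c + m" by (metis le_Suc_ex not_less)
    have "weight (x + h, i + 1, m, l) = W"
      using wt relation3 by (simp add: m algebra_simps)
    from degree_maximal[OF this] show False using c_le_h by (simp add: m)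
  qed
  \<comment> \<open>Together, \<open>relation1\<close> and \<open>relation2\<close> replace
    \<open>X2 ^ b * X3\<close> by \<open>X1 ^ (a + e)\<close>.\<close>
  have j_i: "i < b" if j_pos: "0 < j"
  proof (rule ccontr)
    assume "\<not> ?thesis"
    then obtain m where m: "i = b + m" by (metis le_Suc_ex not_less)
    obtain m' where m': "j = Suc m'" using j_pos by (cases j) auto
    have "weight (x + a + e, m, m', l) = W"
      using wt relation1 relation2 by (simp add: m m' algebra_simps)
    from degree_maximal[OF this] show False using b_bound by (simp add: m m')
  qed
  have i_le: "i \<le> k * b"
  proof (rule ccontr)
    assume "\<not> ?thesis"
    then obtain m where m: "i = k * b + 1 + m"
      by (metis le_Suc_ex not_less_eq_eq Suc_eq_plus1)
    obtain r where r: "c = k + r" using k_le_c le_Suc_ex by blast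
    have "weight (x + p k, m, j + (c - k), l) + k * n3
        = x * n1 + m * n2 + j * n3 + l * n4 + (p k * n1 + c * n3)"
      by (simp add: r algebra_simps)
    then have "weight (x + p k, m, j + (c - k), l) = W"
      using wt relation_p[OF k_pos] by (simp add: m algebra_simps)
    from degree_maximal[OF this] show False using k k_le_c by (simp add: m p_def)
  qed
  \<comment> \<open>Minimality of k gives only a weak inequality here, so the degree might stay the
    same; the contradiction comes from the smaller exponent of X1.\<close>
  have j_x: "x < p (c - j)" if "0 < j" "c - j < k"
  proof (rule ccontr)
    assume *: "\<not> ?thesis"
    define q where "q = c - j"
    have q: "0 < q" "q < k" "c = j + q" using that j_less by (auto simp: q_def)
    obtain m where m: "x = p q + m" using * by (metis le_Suc_ex not_less q_def)
    have wt': "weight (m, i + q * b + 1, 0, l) = W"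
      using wt relation_p[OF q(1)] by (simp add: m q(3) algebra_simps)
    have "(q - 1) * a + (q + 1) * e + c \<le> q * (b + 1)"
      using k_least[OF q(1)] q(2) by (meson not_less)
    then have "x + i + j + l \<le> total_degree (m, i + q * b + 1, 0, l)"
      using q by (simp add: m p_def)
    from first_minimal[OF wt' this] show False by (simp add: m p_def)
  qed
  have "v \<in> normal"
  proof (cases "l = 1")
    case True
    then show ?thesis using l_i l_j l_x by (auto simp: normal_def xijl)
  next
    case False
    then have "l = 0" using l1 by simp
    then show ?thesis using j_less j_i i_le j_x by (auto simp: normal_def xijl)
  qed
  then show ?thesis using v(1) that by (auto simp: Q_def W_def)
qed

section \<open>Distinct normal vectors have distinct weights\<close>

text \<open>For \<open>i < b\<close> and \<open>j < c\<close>, this is the normal vector of weight \<open>y n1 + i n2 + j n3\<close>; the pair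
  \<open>i = b\<close>, \<open>j = 0\<close> stands for the weight \<open>y n1 + n4\<close>.\<close>

definition decode :: "nat \<Rightarrow> nat \<Rightarrow> nat \<Rightarrow> exponents" where
  "decode y i j =
     (if i = b then if y < e then (y, 0, 0, 1) else (y - e, b, 0, 0)
      else if j = 0 \<or> k \<le> c - j \<or> y < p (c - j) then (y, i, j, 0)
      else (y - p (c - j), (c - j) * b + i + 1, 0, 0))"

text \<open>Trading \<open>X2 ^ b\<close> for \<open>X1 ^ e * X4\<close>, or
  \<open>X2 ^ (q * b + 1)\<close> for \<open>X1 ^ p q * X3 ^ (c - q)\<close>, turns the weight into
  a multiple of n1 plus an element of the Apery set.\<close>

lemma normal_eq_decode:
  assumes "u \<in> normal"
  obtains y i j where "i < b \<and> j < c \<or> i = b \<and> j = 0" "u = decode y i j"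
    "weight u = y * n1 + (if i = b then n4 else i * n2 + j * n3)"
proof -
  consider (X4) x where "u = (x, 0, 0, 1)" "x < e"
    | (X2) x i where "u = (x, i, 0, 0)" "i \<le> k * b"
    | (X3) x i j where "u = (x, i, j, 0)" "0 < j" "j < c" "i < b" "c - j < k \<longrightarrow> x < p (c - j)"
    using assms by (auto simp: normal_def)
  then show ?thesis
  proof cases
    case X4
    then show ?thesis using that[of b 0 x] by (simp add: decode_def)
  next
    case X2
    consider "i < b" | "i = b" | "b < i" by linarith
    then show ?thesis
    proof cases
      assume "i < b"
      then show ?thesis using that[of i 0 x] X2 c by (simp add: decode_def)
    next
      assume "i = b"
      then show ?thesis using that[of b 0 "x + e"] X2
        by (simp add: decode_def relation2 algebra_simps)
    next
      assume "b < i"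
      \<comment> \<open>The exponents from \<open>q * b + 1\<close> to \<open>q * b + b\<close>
        share one q, hence the 1 subtracted before dividing; so \<open>i \<le> k * b\<close> yields
        q < k.\<close>
      define q where "q = (i - 1) div b"
      define r where "r = (i - 1) mod b"
      have r: "r < b" using b by (simp add: r_def)
      have i: "i = q * b + r + 1" using \<open>b < i\<close> by (simp add: q_def r_def)
      have "q * b < k * b" using X2(2) i by linarith
      then have q: "q < k" by (metis mult_less_cancel2)
      have q_pos: "0 < q" using i r \<open>b < i\<close> by (cases q) auto
      have qc: "q < c" using q k_le_c by simp
      have "(q * b + 1) * n2 = p q * n1 + (c - q) * n3"
        using relation_p[OF q_pos] qc by (simp add: algebra_simps diff_mult_distrib)
      then have "weight u = (x + p q) * n1 + (r * n2 + (c - q) * n3)"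
        by (simp add: X2 i algebra_simps)
      moreover have "u = decode (x + p q) r (c - q)"
        using r q qc q_pos by (simp add: decode_def X2 i)
      ultimately show ?thesis using that[of r "c - q" "x + p q"] r q_pos c by simp
    qed
  next
    case X3
    then show ?thesis using that[of i j x] by (auto simp: decode_def)
  qed
qed

lemma weight_inj_on_normal: "inj_on weight normal"
proof (rule inj_onI)
  fix u v assume uv: "u \<in> normal" "v \<in> normal" "weight u = weight v"
  define w where "w i j = (if i = b then n4 else i * n2 + j * n3)" for i j
  have cong: "[y * n1 + w i j = (i * c + j) * n3] (mod n1)"
    if "i < b \<and> j < c \<or> i = b \<and> j = 0" for y i j
  proof (cases "i = b")
    case True
    \<comment> \<open>Modulo \<open>n1 = b * c + 1\<close>, \<open>relation1\<close> makes n4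
      congruent to -n3, hence to \<open>b * c * n3\<close>: the pair (b, 0) takes the one index left
      over by the others.\<close>
    have "n1 * n3 = b * c * n3 + n3" by (simp add: n1 algebra_simps)
    then have "n4 + n1 * n3 = a * n1 + b * c * n3" using relation1 by linarith
    then have "(i * c + j) * n3 + (a + y) * n1 = y * n1 + w i j + n3 * n1"
      using that c True by (auto simp: w_def algebra_simps)
    then show ?thesis unfolding cong_iff_lin_nat by blast
  next
    case False
    \<comment> \<open>Modulo n1, \<open>relation3\<close> makes n2 congruent to
      \<open>c * n3\<close>.\<close>
    have "i * (c * n3) = i * (h * n1 + n2)" by (simp only: relation3)
    then have "(i * c + j) * n3 + y * n1 = y * n1 + w i j + i * h * n1"
      using False by (simp add: w_def algebra_simps)
    then show ?thesis unfolding cong_iff_lin_nat by blast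
  qed
  obtain y i j where u: "i < b \<and> j < c \<or> i = b \<and> j = 0" "u = decode y i j"
    "weight u = y * n1 + w i j"
    using normal_eq_decode[OF uv(1)] unfolding w_def by metis
  obtain y' i' j' where v: "i' < b \<and> j' < c \<or> i' = b \<and> j' = 0" "v = decode y' i' j'"
    "weight v = y' * n1 + w i' j'"
    using normal_eq_decode[OF uv(2)] unfolding w_def by metis
  have "[(i * c + j) * n3 = (i' * c + j') * n3] (mod n1)"
    using cong[OF u(1), of y] cong[OF v(1), of y'] uv(3) u(3) v(3) 
    by (metis cong_sym cong_trans)
  then have "[i * c + j = i' * c + j'] (mod n1)"
    using coprime13 by (simp add: cong_mult_rcancel_nat coprime_commute)
  moreover have bound: "i * c + j < n1" if "i < b \<and> j < c \<or> i = b \<and> j = 0" for i j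
  proof (cases "i = b")
    case False
    then have "i * c + j < Suc i * c" "Suc i * c \<le> b * c"
      using that by (simp, intro mult_le_mono1) auto
    then show ?thesis by (simp add: n1)
  qed (use that in \<open>auto simp: n1\<close>)
  ultimately have m: "i * c + j = i' * c + j'"
    using u(1) v(1) by (intro cong_less_modulus_unique_nat) auto
  have j: "j < c" "j' < c" using u(1) v(1) c by auto
  have "(i * c + j) div c = i" "(i' * c + j') div c = i'" using j by simp_all
  with m have "i = i'" "j = j'" by (metis, simp)
  then have "y * n1 = y' * n1" using uv(3) u(3) v(3) by simp
  then have "y = y'" unfolding mult_cancel2 by (simp add: n1)
  with \<open>i = i'\<close> \<open>j = j'\<close> show "u = v" using u(2) v(2) by simp
qed

section \<open>From normal vectors to the Hilbert series\<close>

lemma semigroup_power_eq_weight: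
  "semigroup_power {n1, n2, n3, n4} n = weight ` {u. n \<le> total_degree u}"
proof -
  have sum4: "(\<Sum>g\<in>{n1, n2, n3, n4}. f g) = f n1 + f n2 + f n3 + f n4" for f :: "nat \<Rightarrow> nat"
    using less12 less23 less34 by simp
  show ?thesis
  proof (intro equalityI subsetI)
    fix s assume "s \<in> semigroup_power {n1, n2, n3, n4} n"
    then obtain u where u: "s = (\<Sum>g\<in>{n1, n2, n3, n4}. u g * g)" "n \<le> sum u {n1, n2, n3, n4}"
      unfolding semigroup_power_def by blast
    then show "s \<in> weight ` {u. n \<le> total_degree u}"
      unfolding sum4 by (intro image_eqI[of _ _ "(u n1, u n2, u n3, u n4)"]) auto
  next
    fix s assume "s \<in> weight ` {u. n \<le> total_degree u}"
    then obtain x i j l where "s = weight (x, i, j, l)" "n \<le> x + i + j + l" by auto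
    moreover define u where
      "u g = (if g = n1 then x else if g = n2 then i else if g = n3 then j else l)" for g
    have "u n1 = x" "u n2 = i" "u n3 = j" "u n4 = l"
      using less12 less23 less34 by (simp_all add: u_def)
    ultimately show "s \<in> semigroup_power {n1, n2, n3, n4} n"
      unfolding semigroup_power_def mem_Collect_eq sum4 by (intro exI[of _ u]) simp
  qed
qed

text \<open>A normal vector has the largest degree for its weight: a factorization of larger degree
  could be normalized without losing degree, and by injectivity this would lead back to the same
  normal vector.\<close>

lemma bij_betw_weight:
  "bij_betw weight {u \<in> normal. total_degree u = n}
     (semigroup_power {n1, n2, n3, n4} n - semigroup_power {n1, n2, n3, n4} (Suc n))"
  unfolding bij_betw_def
proof (intro conjI equalityI subsetI)
  show "inj_on weight {u \<in> normal. total_degree u = n}"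
    using weight_inj_on_normal by (rule inj_on_subset) auto
next
  fix s assume "s \<in> weight ` {u \<in> normal. total_degree u = n}"
  then obtain u where u: "u \<in> normal" "total_degree u = n" "s = weight u" by auto
  have False if w: "weight w = s" "Suc n \<le> total_degree w" for w
  proof -
    obtain v where v: "v \<in> normal" "weight v = weight w" "total_degree w \<le> total_degree v"
      by (rule exists_normal)
    then have "v = u" using weight_inj_on_normal u w by (auto dest: inj_onD)
    then show False using v w u by simp
  qed
  then show "s \<in> semigroup_power {n1, n2, n3, n4} n - semigroup_power {n1, n2, n3, n4} (Suc n)"
    using u unfolding semigroup_power_eq_weight by blast
next
  fix s assume s: "s \<in> semigroup_power {n1, n2, n3, n4} n - semigroup_power {n1, n2, n3, n4} (Suc n)"
  then obtain u where u: "s = weight u" "n \<le> total_degree u"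
    unfolding semigroup_power_eq_weight by blast
  obtain v where v: "v \<in> normal" "weight v = weight u" "total_degree u \<le> total_degree v"
    by (rule exists_normal)
  have "\<not> Suc n \<le> total_degree v"
    using s u v unfolding semigroup_power_eq_weight by (metis DiffD2 imageI mem_Collect_eq)
  then show "s \<in> weight ` {u \<in> normal. total_degree u = n}"
    using u v by (intro image_eqI[of _ _ v]) auto
qed

theorem hilbert_series_eq:
  "hilbert_series (semigroup_ring {n1, n2, n3, n4} :: 'a::field fps ring)
     (semigroup_max_ideal {n1, n2, n3, n4}) =
   Abs_fps (\<lambda>n. int (card {u \<in> normal. total_degree u = n}))"
proof -
  have "0 < n1" by (simp add: n1)
  then interpret positive_generators "{n1, n2, n3, n4}"
    using less12 less23 less34 by unfold_locales auto
  show ?thesis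
    unfolding hilbert_series_def
    by (simp add: hilbert_function_semigroup_ring bij_betw_same_card[OF bij_betw_weight])
qed

section \<open>Generating function of the normal vectors\<close>

definition directions :: "(nat \<times> nat \<times> nat) set" where
  "directions = {(0, 0, 1)} \<union> (\<lambda>i. (i, 0, 0)) ` {..k * b} \<union>
     (\<lambda>(j, i). (i, j, 0)) ` ({1..<c} \<times> {..<b})"

text \<open>A direction fixes the exponents of X2, X3 and X4. The admissible exponents of X1 then
  form an initial segment or everything, so their series times \<open>1 - X\<close> is a
  polynomial.\<close>

definition range_of :: "nat \<times> nat \<times> nat \<Rightarrow> nat set" where
  "range_of = (\<lambda>(i, j, l). if l = 1 then {..<e}
     else if 0 < j \<and> c - j < k then {..<p (c - j)} else UNIV)"

lemma normal_eq_directions: "normal = {(x, t). t \<in> directions \<and> x \<in> range_of t}"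
  by (auto simp: normal_def directions_def range_of_def image_iff Suc_le_eq split: if_splits)

text \<open>The three summands belong to the normal monomials containing X4, those in X1 and X2
  alone, and those containing X3.\<close>

lemma hilbert_series_sum:
  defines "X \<equiv> fps_X :: int fps"
  shows "Abs_fps (\<lambda>n. int (card {u \<in> normal. total_degree u = n})) * (1 - X) =
    (1 - X ^ e) * X + (\<Sum>i\<le>k * b. X ^ i) +
    (\<Sum>j\<in>{1..<c}. (1 - (if c - j < k then X ^ p (c - j) else 0)) * X ^ j) * (\<Sum>i<b. X ^ i)"
    (is "?H * _ = _")
proof -
  define d :: "nat \<times> nat \<times> nat \<Rightarrow> nat" where "d = (\<lambda>(i, j, l). i + j + l)"
  define f where "f t = support_series (range_of t) * (1 - X) * X ^ d t" for t
  have f3: "f (i, j, 0) = (1 - (if 0 < j \<and> c - j < k then X ^ p (c - j) else 0)) * X ^ (j + i)" for i j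
    by (simp add: f_def range_of_def d_def X_def support_series_lessThan support_series_UNIV add.commute)
  have fin: "finite directions" by (simp add: directions_def)
  have "{u \<in> normal. total_degree u = n} =
      {(x, t). t \<in> directions \<and> x \<in> range_of t \<and> x + d t = n}" for n
    by (auto simp: normal_eq_directions d_def)
  then have "?H = (\<Sum>t\<in>directions. support_series (range_of t) * fps_X ^ d t)"
    by (simp add: fibre_series_Sigma[OF fin])
  then have "?H * (1 - X) = (\<Sum>t\<in>directions. support_series (range_of t) * fps_X ^ d t * (1 - X))"
    by (simp only: sum_distrib_right)
  also have "\<dots> = (\<Sum>t\<in>directions. f t)"
    by (intro sum.cong refl) (simp add: f_def X_def mult_ac)
  also have "\<dots> = f (0, 0, 1) + (\<Sum>i\<le>k * b. f (i, 0, 0))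
      + (\<Sum>j\<in>{1..<c}. \<Sum>i<b. f (i, j, 0))"
  proof -
    have "(\<Sum>t\<in>directions. f t) = f (0, 0, 1) + sum f ((\<lambda>i. (i, 0, 0)) ` {..k * b})
        + sum f ((\<lambda>(j, i). (i, j, 0)) ` ({1..<c} \<times> {..<b}))"
      unfolding directions_def by (subst sum.union_disjoint; (subst sum.union_disjoint)?) auto
    also have "sum f ((\<lambda>i. (i, 0, 0)) ` {..k * b}) = (\<Sum>i\<le>k * b. f (i, 0, 0))"
      by (subst sum.reindex) (auto simp: inj_on_def)
    also have "sum f ((\<lambda>(j, i). (i, j, 0)) ` ({1..<c} \<times> {..<b})) = (\<Sum>j\<in>{1..<c}. \<Sum>i<b. f (i, j, 0))"
      by (subst sum.reindex) (auto simp: inj_on_def sum.cartesian_product intro!: sum.cong)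
    finally show ?thesis .
  qed
  also have "f (0, 0, 1) = (1 - X ^ e) * X"
    by (simp add: f_def range_of_def d_def X_def support_series_lessThan)
  also have "(\<Sum>i\<le>k * b. f (i, 0, 0)) = (\<Sum>i\<le>k * b. X ^ i)"
    by (simp add: f3)
  also have "(\<Sum>j\<in>{1..<c}. \<Sum>i<b. f (i, j, 0)) =
      (\<Sum>j\<in>{1..<c}. (1 - (if c - j < k then X ^ p (c - j) else 0)) * X ^ j) * (\<Sum>i<b. X ^ i)"
    unfolding sum_product by (intro sum.cong refl) (auto simp: f3 power_add)
  finally show ?thesis .
qed

lemma sum_correction:
  fixes X :: "'b::comm_ring_1"
  shows "(\<Sum>j\<in>{1..<c}. (1 - (if c - j < k then X ^ p (c - j) else 0)) * X ^ j) =
    (\<Sum>j\<in>{1..<c}. X ^ j) - (\<Sum>j = 2..k. X ^ ((k - j) * a + (k - j + 2) * e + c + j - k))"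
proof -
  have "(\<Sum>j\<in>{1..<c}. if c - j < k then X ^ p (c - j) * X ^ j else 0) =
      (\<Sum>j\<in>{j\<in>{1..<c}. c - j < k}. X ^ p (c - j) * X ^ j)"
    by (rule sum.inter_filter[symmetric]) simp
  also have "\<dots> = (\<Sum>j = 2..k. X ^ ((k - j) * a + (k - j + 2) * e + c + j - k))"
  \<comment> \<open>With q = c - j the new index is k + 1 - q, so 0 < q < k becomes the interval
    2..k, and the exponent is \<open>p q + (c - q)\<close>.\<close>
  proof (rule sum.reindex_bij_witness[of _ "\<lambda>j. c + j - k - 1" "\<lambda>j. k + 1 + j - c"])
    fix j assume j: "j \<in> {j \<in> {1..<c}. c - j < k}"
    define q where "q = c - j"
    have q: "0 < q" "q < k" "j = c - q" "q < c" using j by (auto simp: q_def)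
    have "k + 1 + j - c = k - (q - 1)" "k - (k + 1 + j - c) = q - 1" using q by auto
    moreover have "(q - 1) * a + (q - 1 + 2) * e + c + (k - (q - 1)) - k = p q + j"
      using q by (simp add: p_def)
    ultimately have "(k - (k + 1 + j - c)) * a + (k - (k + 1 + j - c) + 2) * e + c + (k + 1 + j - c) - k
        = p (c - j) + j"
      unfolding q_def by (simp only:)
    then show "X ^ ((k - (k + 1 + j - c)) * a + (k - (k + 1 + j - c) + 2) * e + c + (k + 1 + j - c) - k)
        = X ^ p (c - j) * X ^ j"
      by (simp only: power_add)
  qed (use k_le_c in auto)
  finally have "(\<Sum>j\<in>{1..<c}. if c - j < k then X ^ p (c - j) * X ^ j else 0) =
    (\<Sum>j = 2..k. X ^ ((k - j) * a + (k - j + 2) * e + c + j - k))" .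
  moreover have "(1 - (if c - j < k then X ^ p (c - j) else 0)) * X ^ j
      = X ^ j - (if c - j < k then X ^ p (c - j) * X ^ j else 0)" for j
    by (auto simp: left_diff_distrib)
  ultimately show ?thesis by (simp only: sum_subtractf)
qed

theorem hilbert_numerator:
  defines "X \<equiv> fps_X :: int fps"
  shows "Abs_fps (\<lambda>n. int (card {u \<in> normal. total_degree u = n})) * (1 - X) ^ 4 =
    1 - 3 * X ^ 2 + 3 * X ^ 3 - X ^ 4 - X ^ (e + 1) * (1 - X) ^ 3 - X ^ c * (1 - X)
    - X ^ (b + 1) * (1 - X) * (1 - X ^ (c - 1)) - X ^ (k * b + 1) * (1 - X) ^ 2
    - (\<Sum>j = 2..k. X ^ ((k - j) * a + (k - j + 2) * e + c + j - k) * (1 - X) ^ 2 * (1 - X ^ b))"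
    (is "?H * _ = _")
proof -
  define \<Sigma> where "\<Sigma> = (\<Sum>j = 2..k. X ^ ((k - j) * a + (k - j + 2) * e + c + j - k))"
  define C where "C = X ^ (c - 1)"
  have C: "X ^ c = X * C" using c by (simp add: C_def flip: power_Suc)
  have gi: "(\<Sum>i\<le>k * b. X ^ i) * (1 - X) = 1 - X ^ (k * b + 1)"
    using one_diff_power_eq[of X "k * b + 1"] by (simp add: lessThan_Suc_atMost mult.commute)
  have gb: "(\<Sum>i<b. X ^ i) * (1 - X) = 1 - X ^ b"
    using one_diff_power_eq[of X b] by (simp add: mult.commute)
  have gc: "(\<Sum>j\<in>{1..<c}. X ^ j) * (1 - X) = X - X * C"
  proof -
    have "{..<c} = insert 0 {1..<c}" using c by auto
    then have "(\<Sum>j<c. X ^ j) = 1 + (\<Sum>j\<in>{1..<c}. X ^ j)" by simp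
    then have "(\<Sum>j\<in>{1..<c}. X ^ j) * (1 - X) = (1 - X) * (\<Sum>j<c. X ^ j) - (1 - X)"
      by (simp add: algebra_simps)
    moreover have "(1 - X) * (\<Sum>j<c. X ^ j) = 1 - X * C"
      by (simp only: one_diff_power_eq[symmetric] C)
    ultimately show ?thesis by simp
  qed
  \<comment> \<open>Of the four factors \<open>1 - X\<close>, one absorbs the ranges of X1, one the
    geometric sums in X2 and one that in X3; the last survives in every term.\<close>
  have "?H * (1 - X) ^ 4 = ?H * (1 - X) * (1 - X) * (1 - X) ^ 2"
    by (simp add: power_numeral_reduce mult.assoc)
  also have "?H * (1 - X) * (1 - X) = (1 - X ^ e) * X * (1 - X) + (\<Sum>i\<le>k * b. X ^ i) * (1 - X)
      + ((\<Sum>j\<in>{1..<c}. X ^ j) - \<Sigma>) * ((\<Sum>i<b. X ^ i) * (1 - X))"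
    unfolding X_def hilbert_series_sum sum_correction \<Sigma>_def by (simp only: distrib_right mult.assoc)
  also have "\<dots> * (1 - X) ^ 2 = (1 - X ^ e) * X * (1 - X) ^ 3 + (1 - X ^ (k * b + 1)) * (1 - X) ^ 2
      + (((\<Sum>j\<in>{1..<c}. X ^ j) * (1 - X)) * (1 - X) - \<Sigma> * (1 - X) ^ 2) * (1 - X ^ b)"
    unfolding gi gb by (simp add: power2_eq_square power3_eq_cube algebra_simps)
  also have "\<dots> = 1 - 3 * X ^ 2 + 3 * X ^ 3 - X ^ 4 - X ^ (e + 1) * (1 - X) ^ 3 - X ^ c * (1 - X)
    - X ^ (b + 1) * (1 - X) * (1 - C) - X ^ (k * b + 1) * (1 - X) ^ 2
    - \<Sigma> * (1 - X) ^ 2 * (1 - X ^ b)"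
    unfolding gc C by (simp add: power_numeral_reduce algebra_simps)
  finally show ?thesis by (simp add: \<Sigma>_def C_def sum_distrib_right mult.assoc)
qed

end

section \<open>Deduction from Komeda's parametrization\<close>

theorem theorem3p1:
  fixes n1 n2 n3 n4 \<alpha>1 \<alpha>2 \<alpha>3 \<alpha>4 \<alpha>21 k :: nat
    and S :: "nat set"
    and R :: "'a::alg_closed_field fps ring"
    and m :: "'a fps set"
  assumes "0 < n1" and "n1 < n2" and "n2 < n3" and "n3 < n4"
    and "Gcd {n1, n2, n3, n4} = 1"
    and "minimally_generates {n1, n2, n3, n4} S"
    and "pseudo_symmetric S"
    and "\<alpha>1 > 1" and "\<alpha>2 > 1" and "\<alpha>3 > 1" and "\<alpha>4 > 1"
    and "0 < \<alpha>21" and "\<alpha>21 < \<alpha>1 - 1"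
    and "n1 = \<alpha>2 * \<alpha>3 * (\<alpha>4 - 1) + 1"
    and "n2 = \<alpha>21 * \<alpha>3 * \<alpha>4 + (\<alpha>1 - \<alpha>21 - 1) * (\<alpha>3 - 1) + \<alpha>3"
    and "n3 = \<alpha>1 * \<alpha>4 + (\<alpha>1 - \<alpha>21 - 1) * (\<alpha>2 - 1) * (\<alpha>4 - 1) - \<alpha>4 + 1"
    and "n4 = \<alpha>1 * \<alpha>2 * (\<alpha>3 - 1) + \<alpha>21 * (\<alpha>2 - 1) + \<alpha>2"
    and "\<alpha>2 > \<alpha>21 + 1" and "\<alpha>4 = 2"
    and "0 < k"
    and "k * (\<alpha>2 + 1) < (k - 1) * \<alpha>1 + (k + 1) * \<alpha>21 + \<alpha>3"
    and "\<And>j. 0 < j \<Longrightarrow> j * (\<alpha>2 + 1) < (j - 1) * \<alpha>1 + (j + 1) * \<alpha>21 + \<alpha>3 \<Longrightarrow> k \<le> j"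
    and "R = semigroup_ring {n1, n2, n3, n4}"
    and "m = semigroup_max_ideal {n1, n2, n3, n4}"
  shows
    "let t = [:0, 1:] :: int poly;
         r = (if k = 1 then 0
              else \<Sum>j=2..k. t ^ ((k - j) * \<alpha>1 + (k - j + 2) * \<alpha>21 + \<alpha>3 + j - k)
                             * (1 - t) ^ 2 * (1 - t ^ \<alpha>2))
     in hilbert_series R m * (1 - fps_X) ^ 4 =
        fps_of_poly
          (1 - 3 * t ^ 2 + 3 * t ^ 3 - t ^ 4
           - t ^ (\<alpha>21 + 1) * (1 - t) ^ 3
           - t ^ \<alpha>3 * (1 - t)
           - t ^ (\<alpha>2 + 1) * (1 - t) * (1 - t ^ (\<alpha>3 - 1))
           - t ^ (k * \<alpha>2 + 1) * (1 - t) ^ 2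
           - r)"
proof -
  define h where "h = \<alpha>1 - \<alpha>21 - 1"
  have h: "\<alpha>1 = \<alpha>21 + h + 1" "0 < h" using \<open>\<alpha>21 < \<alpha>1 - 1\<close> by (auto simp: h_def)
  obtain B where B: "\<alpha>2 = Suc B" using \<open>\<alpha>2 > 1\<close> by (cases \<alpha>2) auto
  obtain C where C: "\<alpha>3 = Suc C" using \<open>\<alpha>3 > 1\<close> by (cases \<alpha>3) auto
  have n1: "n1 = \<alpha>2 * \<alpha>3 + 1" using assms(14) \<open>\<alpha>4 = 2\<close> by simp
  have n2: "n2 = 2 * \<alpha>21 * \<alpha>3 + h * C + \<alpha>3"
    using assms(15) \<open>\<alpha>4 = 2\<close> by (simp add: h_def C)
  \<comment> \<open>The net subtraction of 1 in the formula for n3 is moved to the left, so that the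
    algebra below is free of truncated subtraction.\<close>
  have n3: "n3 + 1 = 2 * \<alpha>1 + h * B"
    using assms(16) \<open>\<alpha>4 = 2\<close> h by (simp add: B)
  have n4: "n4 = \<alpha>1 * \<alpha>2 * C + \<alpha>21 * B + \<alpha>2"
    using assms(17) by (simp add: B C)
  have relation1: "\<alpha>1 * n1 = n3 + n4"
  proof -
    have "\<alpha>1 * n1 + 1 = n3 + 1 + n4" unfolding n1 n3 n4 h(1) B C by (simp add: algebra_simps)
    then show ?thesis by simp
  qed
  have relation2: "\<alpha>2 * n2 = \<alpha>21 * n1 + n4"
    unfolding n1 n2 n4 h(1) B C by (simp add: algebra_simps)
  have relation3: "\<alpha>3 * n3 = h * n1 + n2"
  proof -
    have "\<alpha>3 * (n3 + 1) = h * n1 + n2 + \<alpha>3"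
      unfolding n1 n2 n3 h(1) B C by (simp add: algebra_simps)
    then show ?thesis by simp
  qed
  \<comment> \<open>By \<open>relation3\<close> and \<open>relation1\<close>, n2 and n4 are integer
    combinations of n1 and n3, so a common divisor of n1 and n3 divides all four generators.\<close>
  have coprime: "coprime n1 n3"
  proof (rule coprimeI)
    fix d assume d: "d dvd n1" "d dvd n3"
    have "d dvd n3 + n4" "d dvd h * n1 + n2"
      unfolding relation1[symmetric] relation3[symmetric] using d by auto
    then have "d dvd n4" "d dvd n2" using d by (simp_all add: dvd_add_right_iff)
    with d have "d dvd Gcd {n1, n2, n3, n4}" by (intro Gcd_greatest) auto
    then show "is_unit d" unfolding \<open>Gcd {n1, n2, n3, n4} = 1\<close> .
  qed
  interpret komeda_semigroup \<alpha>1 \<alpha>2 \<alpha>3 \<alpha>21 h k n1 n2 n3 n4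
  proof unfold_locales
    fix j assume "0 < j" "j * (\<alpha>2 + 1) < (j - 1) * \<alpha>1 + (j + 1) * \<alpha>21 + \<alpha>3"
    then show "k \<le> j" by (rule assms(22))
  qed (use h assms(1-4,9,10,12,18,20,21) n1 relation1 relation2 relation3 coprime in simp_all)
  define t where "t = [:0, 1 :: int:]"
  have t: "fps_of_poly t = fps_X" by (simp add: t_def fps_of_poly_fps_X)
  define r where "r = (\<Sum>j = 2..k. t ^ ((k - j) * \<alpha>1 + (k - j + 2) * \<alpha>21 + \<alpha>3 + j - k)
    * (1 - t) ^ 2 * (1 - t ^ \<alpha>2))"
  \<comment> \<open>For k = 1 the interval 2..k is empty.\<close>
  have r: "(if k = 1 then 0 else r) = r" by (simp add: r_def)
  show ?thesis
    unfolding Let_def assms(23,24) hilbert_series_eq hilbert_numerator t_def[symmetric] r_def[symmetric] r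
    unfolding r_def
    by (simp only: fps_of_poly_diff fps_of_poly_add fps_of_poly_mult fps_of_poly_power
        fps_of_poly_sum fps_of_poly_numeral fps_of_poly_1 t)
qed

end
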